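(* Let $\alpha<0$. Fix $T>0$, let $x_U(t)$ be a solution of Utkin's equivalent control system $\dot x=f_U(x):=f(x,0;U(x))$, where $U(x)\in[-1,1]$ is defined by $g(x,0;U(x))=0$, and assume that $|x_U(t)|<M$ for $0\le t\le T$. Then there exists $\alpha_0>0$ such that, if $\delta_0>0$ and $\kappa<0$ satisfy $$0<\delta_0\le|\kappa|\alpha_0,$$ there exists a constant $L>0$ such that, for any $\alpha<0$ with $0<|\alpha|\le\alpha_0$, with $\varepsilon=\kappa\alpha>0$, the solution $(x(t),y(t),u(t))$ of $$\dot x=f(x,y;u),\qquad \dot y=g(x,y;u),\qquad \varepsilon\dot u=\phi\left(\frac{y+\alpha u}{\varepsilon}\right)-u$$ with $(x(0),y(0),u(0))=(x_0,y_0,u_0)$ such that $x_0=x_U(0)$, $|y_0|<|\alpha|$ and $\big||u_0|-1\big|<\delta_0$, satisfies for all $t\in(0,T)$ $$|x(t)-x_U(t)|<L|\alpha|,\qquad |y(t)|<L|\alpha|.$$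
   Context: Here $x\in\mathbb R^{n-1}$, $y\in\mathbb R$, $u\in\mathbb R$; $f(x,y;u)$, $g(x,y;u)$ are smooth functions of $(x,y,u)$. Standing assumption: $M>0$ is such that, for all $|x|\le M$, $$g(x,0;+1)<0<g(x,0;-1)\quad\text{and}\quad \frac{\partial}{\partial u}g(x,0;u)<0\ \text{ for } u\in[-1,1]$$ (so that $U(x)$ is well defined for $|x|\le M$). The function $\phi:\mathbb R\to[-1,1]$ is smooth with $\phi(w)=\mathrm{sign}(w)$ for $|w|>1$, $\phi(w)\in[-1,1]$ for $|w|\le1$, and $\phi'(w)>0$ for $|w|<1$. The parameter $\kappa$ is by definition $\kappa=\varepsilon/\alpha$; the regime considered is $0<\varepsilon\ll|\alpha|\ll1$, i.e. $|\kappa|$ and $|\alpha|$ small. *)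

theory Defs
  imports "HOL-Analysis.Analysis"
begin

text \<open>
  On a finite-dimensional domain, continuity of all directional derivatives
  \<open>\<lambda>x. Df(x) v\<close> is continuity of \<open>Df\<close>, so the recursion below describes the usual
  class of \<open>k\<close> times continuously differentiable functions.
\<close>

primrec Ck :: "nat \<Rightarrow> ('a::euclidean_space \<Rightarrow> 'b::real_normed_vector) \<Rightarrow> bool" where
  "Ck 0 F \<longleftrightarrow> continuous_on UNIV F"
| "Ck (Suc k) F \<longleftrightarrow>
     (\<forall>x. F differentiable (at x)) \<and> (\<forall>v. Ck k (\<lambda>x. frechet_derivative F (at x) v))"

definition smooth :: "('a::euclidean_space \<Rightarrow> 'b::real_normed_vector) \<Rightarrow> bool" where
  "smooth F \<longleftrightarrow> (\<forall>k. Ck k F)"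

definition regularizing_function :: "(real \<Rightarrow> real) \<Rightarrow> bool" where
  "regularizing_function \<phi> \<longleftrightarrow>
     smooth \<phi> \<and>
     (\<forall>w. \<bar>w\<bar> > 1 \<longrightarrow> \<phi> w = sgn w) \<and>
     (\<forall>w. \<bar>w\<bar> \<le> 1 \<longrightarrow> \<phi> w \<in> {-1..1}) \<and>
     (\<forall>w. \<bar>w\<bar> < 1 \<longrightarrow> deriv \<phi> w > 0)"

text \<open>
  The control \<open>U(x)\<close> is meaningful only where the root exists and is unique; the lemma
  \<open>utkin_control\<close> shows this at every point satisfying the sliding condition.
\<close>

definition utkin_control :: "('a \<Rightarrow> real \<Rightarrow> real \<Rightarrow> real) \<Rightarrow> 'a \<Rightarrow> real" where
  "utkin_control g x = (THE v. v \<in> {-1..1} \<and> g x 0 v = 0)"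

definition utkin_field ::
    "('a \<Rightarrow> real \<Rightarrow> real \<Rightarrow> 'a) \<Rightarrow> ('a \<Rightarrow> real \<Rightarrow> real \<Rightarrow> real) \<Rightarrow> 'a \<Rightarrow> 'a" where
  "utkin_field f g x = f x 0 (utkin_control g x)"

definition sliding_condition :: "('a \<Rightarrow> real \<Rightarrow> real \<Rightarrow> real) \<Rightarrow> 'a \<Rightarrow> bool" where
  "sliding_condition g x \<longleftrightarrow>
     g x 0 1 < 0 \<and> 0 < g x 0 (-1) \<and> (\<forall>v\<in>{-1..1}. deriv (\<lambda>v. g x 0 v) v < 0)"

definition utkin_solution ::
    "('a::real_normed_vector \<Rightarrow> real \<Rightarrow> real \<Rightarrow> 'a) \<Rightarrow> ('a \<Rightarrow> real \<Rightarrow> real \<Rightarrow> real)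
      \<Rightarrow> real \<Rightarrow> (real \<Rightarrow> 'a) \<Rightarrow> bool" where
  "utkin_solution f g T x \<longleftrightarrow>
     (\<forall>t\<in>{0..T}. (x has_vector_derivative utkin_field f g (x t)) (at t within {0..T}))"

definition regularized_solution ::
    "('a::real_normed_vector \<Rightarrow> real \<Rightarrow> real \<Rightarrow> 'a) \<Rightarrow> ('a \<Rightarrow> real \<Rightarrow> real \<Rightarrow> real)
      \<Rightarrow> (real \<Rightarrow> real) \<Rightarrow> real \<Rightarrow> real \<Rightarrow> real
      \<Rightarrow> (real \<Rightarrow> 'a) \<Rightarrow> (real \<Rightarrow> real) \<Rightarrow> (real \<Rightarrow> real) \<Rightarrow> bool" where
  "regularized_solution f g \<phi> \<epsilon> \<alpha> T x y u \<longleftrightarrow>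
     (\<forall>t\<in>{0..T}.
        (x has_vector_derivative f (x t) (y t) (u t)) (at t within {0..T}) \<and>
        (y has_real_derivative g (x t) (y t) (u t)) (at t within {0..T}) \<and>
        (\<exists>u'. (u has_real_derivative u') (at t within {0..T}) \<and>
              \<epsilon> * u' = \<phi> ((y t + \<alpha> * u t) / \<epsilon>) - u t))"

lemma utkin_control:
  fixes g :: "'a::euclidean_space \<Rightarrow> real \<Rightarrow> real \<Rightarrow> real"
  assumes g: "smooth (\<lambda>(x, y, u). g x y u)" and x: "sliding_condition g x"
  shows "\<exists>!v. v \<in> {-1..1} \<and> g x 0 v = 0"
    and "utkin_control g x \<in> {-1..1}" and "g x 0 (utkin_control g x) = 0"
proof -
  have "Ck (Suc 0) (\<lambda>(x, y, u). g x y u)"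
    using g unfolding smooth_def by blast
  then have d: "(\<lambda>(x, y, u). g x y u) differentiable (at z)" for z
    unfolding Ck.simps by blast
  have "((\<lambda>(x, y, u). g x y u) \<circ> (\<lambda>v. (x, 0, v))) differentiable (at v)" for v :: real
    by (rule differentiable_chain_at) (auto intro!: d differentiableI derivative_eq_intros)
  then have "(\<lambda>v. g x 0 v) differentiable (at v)" for v :: real
    by (simp add: o_def)
  then have D: "((\<lambda>v. g x 0 v) has_real_derivative deriv (\<lambda>v. g x 0 v) v) (at v)" for v
    by (simp add: DERIV_deriv_iff_real_differentiable)
  have ex: "\<exists>v. -1 \<le> v \<and> v \<le> 1 \<and> g x 0 v = 0"
    by (rule IVT2) (use x D in \<open>auto simp: sliding_condition_def intro!: DERIV_isCont\<close>)
  have lt: "g x 0 w < g x 0 v" if "-1 \<le> v" "v < w" "w \<le> 1" for v w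
    by (rule DERIV_neg_imp_decreasing[OF \<open>v < w\<close>])
      (use x D that in \<open>force simp: sliding_condition_def\<close>)
  show ex1: "\<exists>!v. v \<in> {-1..1} \<and> g x 0 v = 0"
    using ex lt by (metis atLeastAtMost_iff less_irrefl linorder_neqE)
  show "utkin_control g x \<in> {-1..1}" "g x 0 (utkin_control g x) = 0"
    using theI'[OF ex1] by (simp_all add: utkin_control_def)
qed

end

theory Submission
  imports Defs
begin

text \<open>
  Put \<open>a = -\<alpha>\<close>, \<open>k = -\<kappa>\<close>, so \<open>\<epsilon> = k a\<close>, and rescale \<open>y = a v\<close>. With \<open>p = v - u\<close> the system reads
  \<open>a v' = g\<close>, \<open>k a u' = \<phi>(p / k) - u\<close>, hence \<open>k a p' = k g + u - \<phi>(p / k)\<close>, while \<open>x\<close> moves with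
  bounded speed. For frozen \<open>x\<close> the pair \<open>(v, u)\<close> should relax to the equilibrium \<open>u = U(x)\<close>,
  \<open>p = k W\<close> with \<open>\<phi>(W) = U(x)\<close>, on the time scale \<open>a\<close>. The point is that the rate must be uniform in
  \<open>k\<close>, because \<open>\<alpha>\<^sub>0\<close> is chosen before \<open>\<kappa>\<close>.

  Uniformity comes from monotonicity. Since \<open>g\<close> decreases in \<open>u = v - p\<close>, the \<open>v\<close>-equation increases
  with \<open>p\<close>; and if \<open>k\<close> times the Lipschitz constant of \<open>g\<close> is at most 1, the right hand side
  \<open>k g + u - \<phi>(p / k)\<close> increases with \<open>v\<close>. So \<open>(v, p)\<close> obeys a cooperative system, and a moving corner
  \<open>(v\<^sub>+, p\<^sub>+)\<close> bounds the solution from above as soon as both components of the field at the corner are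
  smaller than the velocity of the corner. The corner
  \<open>v\<^sub>+ = U + k W + (\<eta> + 5) e\<close>, \<open>p\<^sub>+ = k W + 5 e\<close> with \<open>e(t) = exp (-\<rho> t / a) + N a\<close> has this property: at
  the corner \<open>u = U + \<eta> e\<close>, which lies above \<open>U\<close> and does not exceed \<open>\<phi>(W + 5 e / k)\<close>, so both components
  are driven down by an amount proportional to \<open>e\<close>; the summand \<open>N a\<close> pays for the drift of \<open>U\<close> and \<open>W\<close>
  along \<open>x(t)\<close> and for the dependence of \<open>g\<close> on \<open>y\<close>. The factor 5 makes the initial corner large enough
  for every admissible initial value. The reflection \<open>(v, u) \<mapsto> (-v, -u)\<close> gives the lower corner.
  This is \<open>upper_barrier\<close> and \<open>lower_barrier\<close>; they yield \<open>\<bar>y\<bar> < 14 a\<close> and \<open>\<bar>u - U(x)\<bar> < 11 e\<close>.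

  The integral of \<open>e\<close> over bounded time intervals is of order \<open>a\<close>, so a Gronwall type
  barrier for \<open>\<bar>x - x\<^sub>U\<bar>\<close> gives \<open>\<bar>x - x\<^sub>U\<bar> < L a\<close> with \<open>L\<close> independent even of \<open>k\<close>
  (\<open>tracking_in_region\<close>). These estimates presuppose that \<open>(x, y, u)\<close> stays in a compact region, but they
  place it strictly inside that region, so a continuity argument removes the presupposition
  (\<open>tracking\<close>). The same argument yields existence: precomposing the vector field with the projection onto the
  region makes it globally Lipschitz, the resulting global solution satisfies the
  same estimates, hence never leaves the region, and solves the original system.
\<close>

section \<open>Barriers for differentiable functions\<close>

lemma first_contact:
  fixes h :: "real \<Rightarrow> real"
  assumes cont: "continuous_on {0..S} h" and h0: "h 0 < 0" and s: "s \<in> {0..S}" "0 \<le> h s"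
  obtains t where "0 < t" "t \<le> S" "h t = 0" "\<And>r. r \<in> {0..<t} \<Longrightarrow> h r < 0"
proof -
  define K where "K = {0..S} \<inter> h -` {0..}"
  have "closed K"
    unfolding K_def by (intro continuous_closed_preimage cont) auto
  have "s \<in> K" using s by (simp add: K_def)
  have bdd: "bdd_below K" by (auto simp: K_def intro!: bdd_belowI[of _ 0])
  define t where "t = Inf K"
  have "t \<in> K"
    unfolding t_def using \<open>closed K\<close> \<open>s \<in> K\<close> bdd by (intro closed_contains_Inf) auto
  then have t: "0 \<le> t" "t \<le> S" "0 \<le> h t" by (auto simp: K_def)
  have before: "h r < 0" if "r \<in> {0..<t}" for r
  proof (rule ccontr)
    assume "\<not> h r < 0"
    then have "r \<in> K" using that t by (auto simp: K_def)
    then have "t \<le> r" unfolding t_def using bdd by (rule cInf_lower)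
    then show False using that by simp
  qed
  have "0 < t" using t h0 by (cases "t = 0") auto
  moreover have "h t = 0"
  proof (rule ccontr)
    assume "h t \<noteq> 0"
    have "\<exists>r\<ge>0. r \<le> t \<and> h r = 0"
      by (rule IVT') (use t h0 cont in \<open>auto intro: continuous_on_subset\<close>)
    then obtain r where "0 \<le> r" "r \<le> t" "h r = 0" by blast
    then show False using before[of r] \<open>h t \<noteq> 0\<close> by (cases "r = t") auto
  qed
  ultimately show ?thesis using that t before by blast
qed

lemma left_maximum_derivative_nonneg:
  fixes D :: "real \<Rightarrow> real"
  assumes D: "(D has_real_derivative d) (at t within {0..S})" and t: "0 < t" "t \<le> S"
    and max: "\<And>r. r \<in> {0..<t} \<Longrightarrow> D r \<le> D t"
  shows "0 \<le> d"
proof (rule ccontr)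
  assume "\<not> 0 \<le> d"
  then obtain e where e: "e > 0" "\<forall>h>0. t - h \<in> {0..S} \<longrightarrow> h < e \<longrightarrow> D t < D (t - h)"
    using has_real_derivative_neg_dec_left[OF D] by auto
  define h where "h = min (e / 2) (t / 2)"
  have h: "0 < h" "h < e" "h < t" using e t by (auto simp: h_def)
  then have "D t < D (t - h)" using e t by auto
  then show False using max[of "t - h"] h by auto
qed

text \<open>
  At a first contact the difference of the two functions has a left maximum, so its derivative
  cannot be negative there.
\<close>

lemma scalar_barrier:
  fixes h b :: "real \<Rightarrow> real"
  assumes h: "\<And>t. t \<in> {0..S} \<Longrightarrow> (h has_real_derivative h' t) (at t within {0..S})"
    and b: "\<And>t. t \<in> {0..S} \<Longrightarrow> (b has_real_derivative b' t) (at t within {0..S})"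
    and init: "h 0 < b 0"
    and contact: "\<And>t. t \<in> {0..S} \<Longrightarrow> h t = b t \<Longrightarrow> h' t < b' t"
    and t: "t \<in> {0..S}"
  shows "h t < b t"
proof (rule ccontr)
  assume "\<not> h t < b t"
  have der: "((\<lambda>t. h t - b t) has_real_derivative (h' t - b' t)) (at t within {0..S})"
    if "t \<in> {0..S}" for t
    using h[OF that] b[OF that] by (rule DERIV_diff)
  then have "continuous_on {0..S} (\<lambda>t. h t - b t)"
    by (intro DERIV_continuous_on) 
  then obtain s where s: "0 < s" "s \<le> S" "h s - b s = 0"
    "\<And>r. r \<in> {0..<s} \<Longrightarrow> h r - b r < 0"
    using first_contact[of S "\<lambda>t. h t - b t" t] init t \<open>\<not> h t < b t\<close> by auto
  have "0 \<le> h' s - b' s"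
    by (rule left_maximum_derivative_nonneg[OF der]) (use s in \<open>auto intro: less_imp_le\<close>)
  then show False using contact[of s] s by auto
qed

text \<open>
  The differential form of Gronwall's inequality: if the derivative is controlled in
  terms of the norm itself, a strict supersolution of the resulting scalar equation dominates the norm.
\<close>

lemma norm_barrier:
  fixes z :: "real \<Rightarrow> 'a::real_inner" and b :: "real \<Rightarrow> real"
  assumes z: "\<And>t. t \<in> {0..S} \<Longrightarrow> (z has_vector_derivative z' t) (at t within {0..S})"
    and b: "\<And>t. t \<in> {0..S} \<Longrightarrow> (b has_real_derivative b' t) (at t within {0..S})"
    and init: "norm (z 0) < b 0"
    and contact: "\<And>t. t \<in> {0..S} \<Longrightarrow> norm (z t) = b t \<Longrightarrow> norm (z' t) < b' t"
    and pos: "\<And>t. t \<in> {0..S} \<Longrightarrow> 0 < b t"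
    and t: "t \<in> {0..S}"
  shows "norm (z t) < b t"
proof (rule ccontr)
  assume "\<not> norm (z t) < b t"
  have "continuous_on {0..S} z"
    using z has_vector_derivative_continuous continuous_on_eq_continuous_within by blast
  moreover have "continuous_on {0..S} b"
    using b by (rule DERIV_continuous_on)
  ultimately have "continuous_on {0..S} (\<lambda>t. norm (z t) - b t)"
    by (intro continuous_intros)
  then obtain s where s: "0 < s" "s \<le> S" "norm (z s) - b s = 0"
    "\<And>r. r \<in> {0..<s} \<Longrightarrow> norm (z r) - b r < 0"
    using first_contact[of S "\<lambda>t. norm (z t) - b t" t] init t \<open>\<not> norm (z t) < b t\<close> by auto
  have sS: "s \<in> {0..S}" using s by auto
  \<comment> \<open>The norm of \<open>z\<close> need not be differentiable, but its minorant \<open>z \<bullet> n\<close> is, and the two agree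
    at the contact.\<close>
  define n where "n = z s /\<^sub>R norm (z s)"
  have zs: "norm (z s) > 0" using pos[OF sS] s by simp
  then have n: "norm n = 1" by (simp add: n_def)
  have zn: "z s \<bullet> n = norm (z s)"
    using zs by (simp add: n_def power2_norm_eq_inner[symmetric] power2_eq_square)
  have "((\<lambda>t. z t \<bullet> n - b t) has_real_derivative (z' s \<bullet> n - b' s)) (at s within {0..S})"
    using bounded_linear.has_vector_derivative[OF bounded_linear_inner_left z[OF sS], of n] b[OF sS]
    by (intro DERIV_diff) (simp_all add: has_real_derivative_iff_has_vector_derivative)
  then have "0 \<le> z' s \<bullet> n - b' s"
  proof (rule left_maximum_derivative_nonneg)
    fix r assume r: "r \<in> {0..<s}"
    have "z r \<bullet> n \<le> norm (z r)"
      using norm_cauchy_schwarz[of "z r" n] n by simp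
    then show "z r \<bullet> n - b r \<le> z s \<bullet> n - b s" using s(3) s(4)[OF r] zn by simp
  qed (use s in auto)
  moreover have "z' s \<bullet> n \<le> norm (z' s)"
    using norm_cauchy_schwarz[of "z' s" n] n by simp
  ultimately show False using contact[OF sS] s(3) by simp
qed

section \<open>Lipschitz vector fields and their solutions\<close>

lemma bounded_on_compact:
  fixes h :: "'a::topological_space \<Rightarrow> 'b::real_normed_vector"
  assumes "continuous_on S h" "compact S"
  shows "\<exists>C. \<forall>x\<in>S. norm (h x) \<le> C"
  using compact_imp_bounded[OF compact_continuous_image[OF assms]] by (simp add: bounded_iff)

lemma C1_lipschitz_on_compact_convex:
  fixes F :: "'a::euclidean_space \<Rightarrow> 'b::real_normed_vector"
  assumes F: "Ck (Suc 0) F" and S: "compact S" "convex S"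
  obtains L where "L-lipschitz_on S F"
proof -
  have diff: "(F has_derivative frechet_derivative F (at x)) (at x)" for x
    using F by (simp add: frechet_derivative_works)
  have "continuous_on S (\<lambda>x. frechet_derivative F (at x) v)" for v
    using F by (auto intro: continuous_on_subset)
  then have "\<exists>C. \<forall>x\<in>S. norm (frechet_derivative F (at x) v) \<le> C" for v
    using S(1) by (rule bounded_on_compact)
  then obtain C where C: "\<And>v x. x \<in> S \<Longrightarrow> norm (frechet_derivative F (at x) v) \<le> C v"
    by metis
  define L where "L = max 0 (\<Sum>b\<in>Basis. C b)"
  have "onorm (frechet_derivative F (at x)) \<le> L" if x: "x \<in> S" for x
  proof (rule onorm_le)
    fix v
    have lin: "linear (frechet_derivative F (at x))"
      using diff has_derivative_linear by blast
    have "frechet_derivative F (at x) v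
        = frechet_derivative F (at x) (\<Sum>b\<in>Basis. (v \<bullet> b) *\<^sub>R b)"
      by (simp add: euclidean_representation)
    also have "\<dots> = (\<Sum>b\<in>Basis. (v \<bullet> b) *\<^sub>R frechet_derivative F (at x) b)"
      using lin by (simp add: linear_sum linear_cmul)
    also have "norm \<dots> \<le> (\<Sum>b\<in>Basis. norm v * C b)"
    proof (rule sum_norm_le)
      fix b :: 'a assume "b \<in> Basis"
      then show "norm ((v \<bullet> b) *\<^sub>R frechet_derivative F (at x) b) \<le> norm v * C b"
        using C[OF x, of b] Basis_le_norm[of b v] by (simp add: mult_mono)
    qed
    also have "\<dots> \<le> L * norm v"
      unfolding sum_distrib_left[symmetric] L_def
      by (subst mult.commute) (intro mult_right_mono, auto)
    finally show "norm (frechet_derivative F (at x) v) \<le> L * norm v" .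
  qed
  then have "norm (F x - F y) \<le> L * norm (x - y)" if "x \<in> S" "y \<in> S" for x y
    by (intro differentiable_bound[OF S(2) has_derivative_at_withinI[OF diff]] that) auto
  then have "L-lipschitz_on S F"
    by (intro lipschitz_onI) (auto simp: dist_norm L_def)
  then show ?thesis using that by blast
qed

text \<open>
  Picard--Lindelof with Bielecki's weighted norm. Writing the solution as \<open>X t = exp (\<beta> t) z t\<close> turns the
  integral equation into a fixed point equation for \<open>z\<close> whose contraction constant is \<open>L / \<beta>\<close>; a
  weight \<open>\<beta> > L\<close> therefore gives a solution on the whole interval at once, without gluing.
\<close>

lemma global_ode_solution:
  fixes F :: "'a::banach \<Rightarrow> 'a"
  assumes F: "L-lipschitz_on UNIV F" and T: "0 \<le> T"
  obtains X where "X 0 = X0"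
    "\<And>t. t \<in> {0..T} \<Longrightarrow> (X has_vector_derivative F (X t)) (at t within {0..T})"
proof -
  have L: "0 \<le> L" using F lipschitz_on_nonneg by blast
  define \<beta> where "\<beta> = L + 1"
  have \<beta>: "\<beta> > 0" using L by (simp add: \<beta>_def)
  have Fc: "continuous_on UNIV F" using F by (rule lipschitz_on_continuous_on)
  \<comment> \<open>The space of bounded continuous functions lives on the whole line, so functions on \<open>{0..T}\<close> are
    extended by constants, through composition with the clamping map \<open>cl\<close>.\<close>
  define cl where "cl t = max 0 (min T t)" for t :: real
  have cl: "cl t \<in> {0..T}" for t using T by (auto simp: cl_def)
  have cl_id: "cl t = t" if "t \<in> {0..T}" for t using that by (auto simp: cl_def)
  have cl_cont: "continuous_on UNIV cl" unfolding cl_def by (intro continuous_intros)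
  define Q where "Q z t = exp (- \<beta> * t) *\<^sub>R
      (X0 + integral {0..t} (\<lambda>s. F (exp (\<beta> * s) *\<^sub>R z s)))" for z :: "real \<Rightarrow> 'a" and t
  have integrand: "continuous_on A (\<lambda>s. F (exp (\<beta> * s) *\<^sub>R apply_bcontfun z s))"
    for z :: "real \<Rightarrow>\<^sub>C 'a" and A
    by (intro continuous_on_compose2[OF Fc] continuous_intros) auto
  have primitive: "((\<lambda>t. integral {0..t} (\<lambda>s. F (exp (\<beta> * s) *\<^sub>R apply_bcontfun z s)))
      has_vector_derivative F (exp (\<beta> * t) *\<^sub>R apply_bcontfun z t)) (at t within {0..T})"
    if "t \<in> {0..T}" for z :: "real \<Rightarrow>\<^sub>C 'a" and t
    by (rule integral_has_vector_derivative[OF integrand that])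
  have Qcont: "continuous_on {0..T} (Q z)" for z :: "real \<Rightarrow>\<^sub>C 'a"
    unfolding Q_def
    by (intro continuous_intros indefinite_integral_continuous_1 integrable_continuous_real integrand)
  have QB: "(\<lambda>t. Q z (cl t)) \<in> bcontfun" for z :: "real \<Rightarrow>\<^sub>C 'a"
  proof -
    have "continuous_on UNIV (\<lambda>t. Q z (cl t))"
      by (rule continuous_on_compose2[OF Qcont cl_cont]) (use cl in auto)
    moreover obtain B where "\<forall>t\<in>{0..T}. norm (Q z t) \<le> B"
      using bounded_on_compact[OF Qcont compact_Icc] by blast
    ultimately show ?thesis using cl by (intro bcontfun_normI[where b = B]) auto
  qed
  define P where "P z = Bcontfun (\<lambda>t. Q (apply_bcontfun z) (cl t))" for z :: "real \<Rightarrow>\<^sub>C 'a"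
  have P: "apply_bcontfun (P z) t = Q z (cl t)" for z :: "real \<Rightarrow>\<^sub>C 'a" and t
    unfolding P_def by (simp add: Bcontfun_inverse[OF QB])
  have "dist (P z) (P z') \<le> (L / \<beta>) * dist z z'" for z z' :: "real \<Rightarrow>\<^sub>C 'a"
  proof (rule dist_bound)
    fix t'
    define t where "t = cl t'"
    have t: "t \<in> {0..T}" unfolding t_def by (rule cl)
    define d where "d = dist z z'"
    have d: "0 \<le> d" by (simp add: d_def)
    let ?I = "\<lambda>z s. F (exp (\<beta> * s) *\<^sub>R apply_bcontfun z s)"
    have weight: "((\<lambda>s. L * d * exp (\<beta> * s)) has_integral
        (L * d * exp (\<beta> * t) / \<beta> - L * d * exp (\<beta> * 0) / \<beta>)) {0..t}"
      by (rule fundamental_theorem_of_calculus)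
        (use t \<beta> in \<open>auto intro!: derivative_eq_intros
          simp: has_real_derivative_iff_has_vector_derivative[symmetric]\<close>)
    have "norm (integral {0..t} (?I z) - integral {0..t} (?I z'))
        = norm (integral {0..t} (\<lambda>s. ?I z s - ?I z' s))"
      by (subst Henstock_Kurzweil_Integration.integral_diff)
        (auto intro!: integrable_continuous_real integrand)
    also have "\<dots> \<le> integral {0..t} (\<lambda>s. L * d * exp (\<beta> * s))"
    proof (rule integral_norm_bound_integral)
      fix s
      have "norm (?I z s - ?I z' s) \<le> L * norm (exp (\<beta> * s) *\<^sub>R z s - exp (\<beta> * s) *\<^sub>R z' s)"
        using lipschitz_onD[OF F, of "exp (\<beta> * s) *\<^sub>R z s" "exp (\<beta> * s) *\<^sub>R z' s"]
        by (simp add: dist_norm)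
      also have "\<dots> = L * (exp (\<beta> * s) * dist (z s) (z' s))"
        by (simp add: scaleR_diff_right[symmetric] dist_norm)
      also have "\<dots> \<le> L * (exp (\<beta> * s) * d)"
        unfolding d_def using L by (intro mult_left_mono dist_bounded) auto
      finally show "norm (?I z s - ?I z' s) \<le> L * d * exp (\<beta> * s)" by (simp add: ac_simps)
    next
      show "(\<lambda>s. ?I z s - ?I z' s) integrable_on {0..t}"
        by (intro integrable_diff integrable_continuous_real integrand)
      show "(\<lambda>s. L * d * exp (\<beta> * s)) integrable_on {0..t}"
        using weight by blast
    qed
    also have "\<dots> = L * d * exp (\<beta> * t) / \<beta> - L * d / \<beta>"
      using integral_unique[OF weight] by simp
    also have "\<dots> \<le> L * d * exp (\<beta> * t) / \<beta>" using L d \<beta> by simp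
    finally have I: "norm (integral {0..t} (?I z) - integral {0..t} (?I z'))
        \<le> L * d * exp (\<beta> * t) / \<beta>" .
    have "dist (P z t') (P z' t')
        = exp (- \<beta> * t) * norm (integral {0..t} (?I z) - integral {0..t} (?I z'))"
      by (simp add: P t_def[symmetric] Q_def dist_norm scaleR_diff_right[symmetric])
    also have "\<dots> \<le> exp (- \<beta> * t) * (L * d * exp (\<beta> * t) / \<beta>)"
      using I by (intro mult_left_mono) auto
    also have "\<dots> = (L / \<beta>) * d" by (simp add: exp_minus field_simps)
    finally show "dist (P z t') (P z' t') \<le> (L / \<beta>) * dist z z'" by (simp add: d_def)
  qed
  then obtain z where z: "P z = z"
    using banach_fix_type[of "L / \<beta>" P] L by (auto simp: \<beta>_def)
  define X where "X t = exp (\<beta> * t) *\<^sub>R apply_bcontfun z t" for t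
  have X: "X t = X0 + integral {0..t} (\<lambda>s. F (X s))" if "t \<in> {0..T}" for t
  proof -
    have "apply_bcontfun z t = Q z t" using P[of z t] z cl_id[OF that] by simp
    then have "X t = exp (\<beta> * t) *\<^sub>R Q z t" by (simp add: X_def)
    also have "\<dots> = X0 + integral {0..t} (\<lambda>s. F (X s))"
      by (simp add: Q_def X_def exp_minus)
    finally show ?thesis .
  qed
  show ?thesis
  proof
    show "X 0 = X0" using X[of 0] T by simp
    fix t assume t: "t \<in> {0..T}"
    have "((\<lambda>t. X0 + integral {0..t} (\<lambda>s. F (X s))) has_vector_derivative F (X t))
        (at t within {0..T})"
      using primitive[OF t, of z] by (auto simp: X_def intro!: derivative_eq_intros)
    then show "(X has_vector_derivative F (X t)) (at t within {0..T})"
      by (rule has_vector_derivative_transform[OF t, rotated]) (simp add: X)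
  qed
qed

text \<open>
  A field that is Lipschitz only on a compact convex set \<open>Q\<close> becomes globally Lipschitz when precomposed
  with the nearest point projection onto \<open>Q\<close>. The solution of the modified equation exists on
  the whole time interval and solves the original one until it leaves \<open>Q\<close>.
\<close>

lemma solution_until_exit:
  fixes F :: "'a::euclidean_space \<Rightarrow> 'a"
  assumes F: "L-lipschitz_on Q F" and Q: "compact Q" "convex Q" "Q \<noteq> {}" and T: "0 \<le> T"
  obtains X where "X 0 = X0" "continuous_on {0..T} X"
    "\<And>S t. S \<in> {0..T} \<Longrightarrow> (\<And>t. t \<in> {0..S} \<Longrightarrow> X t \<in> Q) \<Longrightarrow> t \<in> {0..S} \<Longrightarrow>
      (X has_vector_derivative F (X t)) (at t within {0..S})"
proof -
  have closed: "closed Q" using Q by (simp add: compact_imp_closed)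
  have "1-lipschitz_on UNIV (closest_point Q)"
    using closest_point_lipschitz[OF Q(2) closed Q(3)] by (intro lipschitz_onI) auto
  moreover have "L-lipschitz_on (closest_point Q ` UNIV) F"
    by (rule lipschitz_on_subset[OF F]) (use closest_point_in_set[OF closed Q(3)] in auto)
  ultimately have "(L * 1)-lipschitz_on UNIV (F \<circ> closest_point Q)"
    by (rule lipschitz_on_compose)
  then obtain X where X: "X 0 = X0" "\<And>t. t \<in> {0..T} \<Longrightarrow>
      (X has_vector_derivative (F \<circ> closest_point Q) (X t)) (at t within {0..T})"
    using global_ode_solution[OF _ T] by metis
  show ?thesis
  proof (rule that)
    show "continuous_on {0..T} X"
      using X(2) has_vector_derivative_continuous continuous_on_eq_continuous_within by blast
    fix S t assume S: "S \<in> {0..T}" "t \<in> {0..S}" and inQ: "\<And>t. t \<in> {0..S} \<Longrightarrow> X t \<in> Q"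
    have "(X has_vector_derivative (F \<circ> closest_point Q) (X t)) (at t within {0..S})"
      by (rule has_vector_derivative_within_subset[OF X(2)]) (use S in auto)
    then show "(X has_vector_derivative F (X t)) (at t within {0..S})"
      using closest_point_self[OF inQ[OF S(2)]] by simp
  qed (rule X)
qed

section \<open>The regularizing function\<close>

lemma Ck_real_derivative:
  fixes h :: "real \<Rightarrow> real"
  assumes "Ck (Suc 0) h"
  shows "(h has_real_derivative deriv h w) (at w)" and "continuous_on UNIV (deriv h)"
proof -
  have diff: "h differentiable (at w)" for w using assms by simp
  show D: "(h has_real_derivative deriv h w) (at w)" for w
    using diff by (simp add: DERIV_deriv_iff_real_differentiable)
  have "deriv h = (\<lambda>w. frechet_derivative h (at w) 1)"
    using frechet_derivative_at[OF D[unfolded has_field_derivative_def]] by (metis mult.right_neutral)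
  then show "continuous_on UNIV (deriv h)" using assms by simp
qed

lemma regularizing_function_bound:
  assumes "regularizing_function \<phi>"
  shows "\<bar>\<phi> w\<bar> \<le> 1"
  using assms unfolding regularizing_function_def
  by (cases "\<bar>w\<bar> \<le> 1") (auto simp: sgn_if abs_le_iff)

text \<open>
  On levels that stay \<open>\<theta>\<close> away from \<open>\<plusminus>1\<close> the function \<open>\<phi>\<close> has a Lipschitz right inverse \<open>\<psi>\<close>. The last two
  properties quantify how far \<open>\<phi>\<close> rises above or falls below a level at distance \<open>s\<close> from its
  preimage: linearly at first, and by at least \<open>\<theta> / 2\<close> once the steep part of \<open>\<phi>\<close> is left. They hold for
  all \<open>s \<ge> 0\<close>, which is what makes the barriers below global.
\<close>

lemma regularizing_function_inverse:
  assumes \<phi>: "regularizing_function \<phi>" and \<theta>: "0 < \<theta>" "\<theta> \<le> 1"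
  obtains \<psi> :: "real \<Rightarrow> real" and c :: real where "0 < c"
    "\<And>p. \<bar>p\<bar> \<le> 1 - \<theta> \<Longrightarrow> \<bar>\<psi> p\<bar> \<le> 1"
    "\<And>p q. \<bar>p\<bar> \<le> 1 - \<theta> \<Longrightarrow> \<bar>q\<bar> \<le> 1 - \<theta> \<Longrightarrow> \<bar>\<psi> p - \<psi> q\<bar> \<le> \<bar>p - q\<bar> / c"
    "\<And>p s. \<bar>p\<bar> \<le> 1 - \<theta> \<Longrightarrow> 0 \<le> s \<Longrightarrow> p + min (c * s) (\<theta> / 2) \<le> \<phi> (\<psi> p + s)"
    "\<And>p s. \<bar>p\<bar> \<le> 1 - \<theta> \<Longrightarrow> 0 \<le> s \<Longrightarrow> \<phi> (\<psi> p - s) \<le> p - min (c * s) (\<theta> / 2)"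
proof -
  have C1: "Ck (Suc 0) \<phi>" using \<phi> unfolding regularizing_function_def smooth_def by blast
  note D = Ck_real_derivative(1)[OF C1] and D_cont = Ck_real_derivative(2)[OF C1]
  have cont: "continuous_on A \<phi>" for A
    using D by (meson DERIV_continuous_on has_field_derivative_at_within)
  have out: "\<And>w. \<bar>w\<bar> > 1 \<Longrightarrow> \<phi> w = sgn w" and pos: "\<And>w. \<bar>w\<bar> < 1 \<Longrightarrow> 0 < deriv \<phi> w"
    using \<phi> unfolding regularizing_function_def by auto
  have top: "\<phi> w = 1" if "1 \<le> w" for w
    using continuous_constant_on_closure[OF cont, of "{1<..}" 1 w] out that by auto
  have bot: "\<phi> w = -1" if "w \<le> -1" for w
    using continuous_constant_on_closure[OF cont, of "{..<-1}" "-1" w] out that by auto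
  have inc: "\<phi> w < \<phi> w'" if "-1 \<le> w" "w < w'" "w' \<le> 1" for w w'
    by (rule DERIV_pos_imp_increasing_open[OF \<open>w < w'\<close>]) (use D pos that cont in force)+
  have mono: "\<phi> w \<le> \<phi> w'" if "w \<le> w'" for w w'
  proof -
    consider "w \<le> -1" | "1 \<le> w'" | "-1 \<le> w" "w' \<le> 1" by linarith
    then show ?thesis
    proof cases
      case 1 then show ?thesis
        using bot[of w] regularizing_function_bound[OF \<phi>, of w'] by (simp add: abs_le_iff)
    next
      case 2 then show ?thesis
        using top[of w'] regularizing_function_bound[OF \<phi>, of w] by (simp add: abs_le_iff)
    next
      case 3 then show ?thesis using inc[of w w'] that by (cases "w = w'") auto
    qed
  qed
  \<comment> \<open>Preimages of levels at distance \<open>\<theta> / 2\<close> from \<open>\<plusminus>1\<close> bound a compact interval on which \<open>\<phi>'\<close>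
    is bounded below; the other half of \<open>\<theta>\<close> is the guaranteed rise beyond that interval.\<close>
  have "\<exists>w\<ge>-1. w \<le> 1 \<and> \<phi> w = 1 - \<theta> / 2"
    by (rule IVT') (use top[of 1] bot[of "-1"] \<theta> cont in auto)
  then obtain w1 where w1: "-1 \<le> w1" "w1 \<le> 1" "\<phi> w1 = 1 - \<theta> / 2" by blast
  have "\<exists>w\<ge>-1. w \<le> 1 \<and> \<phi> w = - 1 + \<theta> / 2"
    by (rule IVT') (use top[of 1] bot[of "-1"] \<theta> cont in auto)
  then obtain w2 where w2: "-1 \<le> w2" "w2 \<le> 1" "\<phi> w2 = - 1 + \<theta> / 2" by blast
  have w1': "w1 < 1" using w1 top[of w1] \<theta> by (cases "w1 = 1") auto
  have w2': "-1 < w2" using w2 bot[of w2] \<theta> by (cases "w2 = -1") auto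
  have w21: "w2 < w1" using mono[of w1 w2] w1 w2 \<theta> by linarith
  have "\<exists>m\<in>{w2..w1}. \<forall>w\<in>{w2..w1}. deriv \<phi> m \<le> deriv \<phi> w"
    by (rule continuous_attains_inf) (use w21 D_cont in \<open>auto intro: continuous_on_subset\<close>)
  then obtain m where m: "m \<in> {w2..w1}" "\<And>w. w \<in> {w2..w1} \<Longrightarrow> deriv \<phi> m \<le> deriv \<phi> w" by blast
  define c where "c = deriv \<phi> m"
  have c: "0 < c" unfolding c_def by (rule pos) (use m(1) w1' w2' in auto)
  have steep: "c * (b - a) \<le> \<phi> b - \<phi> a" if "w2 \<le> a" "a \<le> b" "b \<le> w1" for a b
  proof (cases "a = b")
    case False
    then have "a < b" using that by simp
    then obtain z where "a < z" "z < b" "\<phi> b - \<phi> a = (b - a) * deriv \<phi> z"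
      using MVT2[of a b \<phi> "deriv \<phi>"] D by blast
    then show ?thesis using m(2)[of z] that by (simp add: c_def mult.commute mult_right_mono)
  qed simp
  have "\<exists>w. w2 \<le> w \<and> w \<le> w1 \<and> \<phi> w = p" if "\<bar>p\<bar> \<le> 1 - \<theta>" for p
    using IVT'[of \<phi> w2 p w1] that w1 w2 w21 \<theta> cont by auto
  then obtain \<psi> where \<psi>: "\<And>p. \<bar>p\<bar> \<le> 1 - \<theta> \<Longrightarrow> w2 \<le> \<psi> p \<and> \<psi> p \<le> w1 \<and> \<phi> (\<psi> p) = p"
    by metis
  show ?thesis
  proof
    show "0 < c" by (rule c)
    show "\<bar>\<psi> p\<bar> \<le> 1" if "\<bar>p\<bar> \<le> 1 - \<theta>" for p using \<psi>[OF that] w1 w2 by auto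
    show "\<bar>\<psi> p - \<psi> q\<bar> \<le> \<bar>p - q\<bar> / c" if "\<bar>p\<bar> \<le> 1 - \<theta>" "\<bar>q\<bar> \<le> 1 - \<theta>" for p q
    proof -
      have "c * \<bar>\<psi> p - \<psi> q\<bar> \<le> \<bar>p - q\<bar>"
        using steep[of "\<psi> p" "\<psi> q"] steep[of "\<psi> q" "\<psi> p"] \<psi>[OF that(1)] \<psi>[OF that(2)]
        by (cases "\<psi> p \<le> \<psi> q") auto
      then show ?thesis using c by (simp add: field_simps)
    qed
    fix p s :: real assume p: "\<bar>p\<bar> \<le> 1 - \<theta>" and s: "0 \<le> s"
    show "p + min (c * s) (\<theta> / 2) \<le> \<phi> (\<psi> p + s)"
    proof (cases "\<psi> p + s \<le> w1")
      case True
      then show ?thesis using steep[of "\<psi> p" "\<psi> p + s"] \<psi>[OF p] s by auto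
    next
      case False
      then show ?thesis using mono[of w1 "\<psi> p + s"] w1 p by linarith
    qed
    show "\<phi> (\<psi> p - s) \<le> p - min (c * s) (\<theta> / 2)"
    proof (cases "w2 \<le> \<psi> p - s")
      case True
      then show ?thesis using steep[of "\<psi> p - s" "\<psi> p"] \<psi>[OF p] s by auto
    next
      case False
      then show ?thesis using mono[of "\<psi> p - s" w2] w2 p by linarith
    qed
  qed
qed

section \<open>The fast subsystem: uniform relaxation by moving corners\<close>

text \<open>
  The scaled pair \<open>(v, u)\<close> with \<open>v = y / a\<close>, driven by time dependent data: \<open>G t p\<close> stands for
  \<open>g (x t) (y t) p\<close>, \<open>U t\<close> for the equivalent control at \<open>x t\<close>, and \<open>W t\<close> for its preimage under \<open>\<phi>\<close>. \<open>U\<close>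
  and \<open>W\<close> enter through Lipschitz bounds in time, which the strict decrease of \<open>g\<close> in \<open>u\<close> provides
  without the implicit function theorem. All assumptions are symmetric under reflection in the origin. The constants are
  those of the corner: \<open>\<eta>\<close> the excess of its \<open>u\<close>-value over \<open>U\<close> relative to \<open>e\<close>, \<open>\<rho>\<close> its rate of decay, and \<open>N\<close> its final size relative to \<open>a\<close>.
\<close>

locale fast_subsystem =
  fixes S a k \<delta> \<gamma> \<Lambda> \<theta> c C l \<eta> \<rho> N :: real
    and \<phi> v u U W :: "real \<Rightarrow> real"
    and G :: "real \<Rightarrow> real \<Rightarrow> real"
  assumes a: "0 < a" and k: "0 < k" "k \<le> 1" "k * \<Lambda> \<le> 1" and \<gamma>: "0 < \<gamma>" and \<delta>: "0 < \<delta>"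
    and l: "0 \<le> l" and C: "0 \<le> C" and \<theta>: "\<theta> \<le> 1"
    and \<eta>: "0 < \<eta>" "\<eta> \<le> c" "\<eta> \<le> \<theta> / 4"
    and \<rho>: "0 < \<rho>" "\<rho> * (\<eta> + 5) \<le> \<gamma> * \<eta> / 2"
    and N: "C + 2 * l \<le> \<gamma> * \<eta> / 2 * N" "N * a \<le> 1"
    and dv: "\<And>t. t \<in> {0..S} \<Longrightarrow> (v has_real_derivative G t (u t) / a) (at t within {0..S})"
    and du: "\<And>t. t \<in> {0..S} \<Longrightarrow>
      (u has_real_derivative (\<phi> ((v t - u t) / k) - u t) / (k * a)) (at t within {0..S})"
    and U_lip: "\<And>t s. t \<in> {0..S} \<Longrightarrow> s \<in> {0..S} \<Longrightarrow> \<bar>U t - U s\<bar> \<le> l * \<bar>t - s\<bar>"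
    and W_lip: "\<And>t s. t \<in> {0..S} \<Longrightarrow> s \<in> {0..S} \<Longrightarrow> \<bar>W t - W s\<bar> \<le> l * \<bar>t - s\<bar>"
    and drift: "\<And>t p q. t \<in> {0..S} \<Longrightarrow> \<bar>p\<bar> \<le> 1 + \<delta> \<Longrightarrow> \<bar>q\<bar> \<le> 1 + \<delta> \<Longrightarrow> p \<le> q \<Longrightarrow>
      \<gamma> * (q - p) \<le> G t p - G t q \<and> G t p - G t q \<le> \<Lambda> * (q - p)"
    and drift_U: "\<And>t. t \<in> {0..S} \<Longrightarrow> \<bar>G t (U t)\<bar> \<le> C * a"
    and U_bound: "\<And>t. t \<in> {0..S} \<Longrightarrow> \<bar>U t\<bar> \<le> 1 - \<theta>"
    and W_bound: "\<And>t. t \<in> {0..S} \<Longrightarrow> \<bar>W t\<bar> \<le> 1"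
    and \<phi>_above: "\<And>t s. t \<in> {0..S} \<Longrightarrow> 0 \<le> s \<Longrightarrow> U t + min (c * s) (\<theta> / 2) \<le> \<phi> (W t + s)"
    and \<phi>_below: "\<And>t s. t \<in> {0..S} \<Longrightarrow> 0 \<le> s \<Longrightarrow> \<phi> (W t - s) \<le> U t - min (c * s) (\<theta> / 2)"
    and u_bound: "\<And>t. t \<in> {0..S} \<Longrightarrow> \<bar>u t\<bar> \<le> 1 + \<delta>"
    and \<delta>1: "\<delta> \<le> 1"
    and init: "\<bar>v 0\<bar> < 1"
begin

definition envelope :: "real \<Rightarrow> real" where
  "envelope t = exp (- (\<rho> / a) * t) + N * a"

lemma N_nonneg: "0 \<le> N"
proof -
  have "0 \<le> \<gamma> * \<eta> / 2 * N" using N(1) C l by linarith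
  moreover have "0 < \<gamma> * \<eta>" using \<gamma> \<eta> by simp
  ultimately show ?thesis by (auto simp: zero_le_mult_iff)
qed

lemma envelope_bounds:
  assumes "0 \<le> t"
  shows "N * a < envelope t" and "0 < envelope t" and "envelope t \<le> 2"
proof -
  show 1: "N * a < envelope t" by (simp add: envelope_def)
  show "0 < envelope t" using 1 N_nonneg a by (smt (verit) mult_nonneg_nonneg)
  have "exp (- (\<rho> / a) * t) \<le> 1" using assms \<rho> a by simp
  then show "envelope t \<le> 2" using N(2) unfolding envelope_def by linarith
qed

lemma envelope_deriv:
  "(envelope has_real_derivative - (\<rho> / a) * (envelope t - N * a)) (at t within A)"
  unfolding envelope_def using a by (auto intro!: derivative_eq_intros)

text \<open>
  The decaying corner is never reached. On the edge \<open>v = v\<^sub>+\<close> one has \<open>u \<ge> q\<close>, and on the edge \<open>p = p\<^sub>+\<close>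
  one has \<open>u \<le> q\<close>, where \<open>q = U + \<eta> e\<close> is the value of \<open>u\<close> at the corner itself; monotonicity of \<open>G\<close> in
  the first case and of \<open>u + k G\<close> in the second reduces both edges to the corner. There the drift
  \<open>-\<gamma> \<eta> e\<close> beats the speed of the corner, which is at most \<open>\<gamma> \<eta> / 2\<close> times the decaying part of \<open>e\<close>
  plus slow terms of order \<open>a\<close>.
\<close>

lemma upper_barrier:
  assumes t: "t \<in> {0..S}"
  shows "v t < U t + k * W t + (\<eta> + 5) * envelope t" and "v t - u t < k * W t + 5 * envelope t"
proof -
  define h where "h r = max (v r - (U r + k * W r + (\<eta> + 5) * envelope r))
      (v r - u r - (k * W r + 5 * envelope r))" for r
  have S: "0 \<in> {0..S}" using t by auto
  have lip_cont: "continuous_on {0..S} f"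
    if "\<And>t s. t \<in> {0..S} \<Longrightarrow> s \<in> {0..S} \<Longrightarrow> \<bar>f t - f s\<bar> \<le> l * \<bar>t - s\<bar>" for f :: "real \<Rightarrow> real"
    by (rule lipschitz_on_continuous_on[OF lipschitz_onI]) (use that l in \<open>auto simp: dist_real_def\<close>)
  have cont: "continuous_on {0..S} h"
    unfolding h_def
    by (intro continuous_intros lip_cont U_lip W_lip DERIV_continuous_on[OF dv]
        DERIV_continuous_on[OF du] DERIV_continuous_on[OF envelope_deriv])
  have kW0: "\<bar>k * W 0\<bar> \<le> 1"
    using W_bound[OF S] k by (simp add: abs_mult mult_le_one)
  have e0: "1 \<le> envelope 0" using N_nonneg a by (simp add: envelope_def)
  have "0 \<le> \<eta> * envelope 0" using \<eta> e0 by simp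
  then have "h 0 < 0"
    using kW0 e0 U_bound[OF S] \<eta> init u_bound[OF S] \<delta>1
    unfolding h_def max_less_iff_conj distrib_right abs_le_iff abs_less_iff by linarith
  have "h t < 0"
  proof (rule ccontr)
    assume "\<not> h t < 0"
    then obtain s where s: "0 < s" "s \<le> S" "h s = 0" and before: "\<And>r. r \<in> {0..<s} \<Longrightarrow> h r < 0"
      using first_contact[OF cont \<open>h 0 < 0\<close> t] by auto
    have sS: "s \<in> {0..S}" using s by simp
    define E where "E = envelope s"
    have E: "N * a < E" "0 < E" "E \<le> 2" using envelope_bounds[of s] s by (auto simp: E_def)
    have \<eta>E: "0 < \<eta> * E" "\<eta> * E \<le> \<theta> / 2"
      using \<eta> E mult_mono[of \<eta> "\<theta> / 4" E 2] by auto
    define q where "q = U s + \<eta> * E"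
    have q: "\<bar>q\<bar> \<le> 1 + \<delta>" "U s \<le> q" "\<bar>U s\<bar> \<le> 1 + \<delta>"
      using U_bound[OF sS] \<eta>E \<delta> \<theta> unfolding q_def by linarith+
    have Gq: "G s q \<le> - \<gamma> * (\<eta> * E) + C * a"
      using drift[OF sS q(3) q(1) q(2)] drift_U[OF sS] by (auto simp: q_def)
    have decay: "(\<eta> + 5) * \<rho> * (E - N * a) \<le> \<gamma> * \<eta> / 2 * (E - N * a)"
      using \<rho>(2) E(1) by (intro mult_right_mono) (auto simp: mult.commute)
    have slow: "(C + 2 * l) * a \<le> \<gamma> * \<eta> / 2 * (N * a)"
      using mult_right_mono[OF N(1), of a] a by (simp add: mult.assoc)
    have "0 < \<gamma> * (\<eta> * E)" using \<gamma> \<eta>E by simp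
    then have contra: "\<not> 0 \<le> G s q + 2 * l * a + (\<eta> + 5) * \<rho> * (E - N * a)"
      using Gq decay slow by (simp add: algebra_simps)
    have hs: "v s - (U s + k * W s + (\<eta> + 5) * E) \<le> 0" "v s - u s - (k * W s + 5 * E) \<le> 0"
      "v s - (U s + k * W s + (\<eta> + 5) * E) = 0 \<or> v s - u s - (k * W s + 5 * E) = 0"
      using s(3) unfolding h_def E_def[symmetric] by (auto simp: max_def split: if_splits)
    \<comment> \<open>Since \<open>U\<close> and \<open>W\<close> are merely Lipschitz, the barrier is replaced near the contact by a
      larger, differentiable one that takes the same value at \<open>s\<close>.\<close>
    have lip: "W r \<le> W s + l * (s - r)" and Ur: "U r \<le> U s + l * (s - r)"
      if "r \<in> {0..<s}" for r
      using W_lip[of r s] U_lip[of r s] that sS by (auto simp: abs_le_iff)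
    have Wr: "k * W r \<le> k * (W s + l * (s - r))" if "r \<in> {0..<s}" for r
      using lip[OF that] k by simp
    show False using hs(3)
    proof
      assume v_contact: "v s - (U s + k * W s + (\<eta> + 5) * E) = 0"
      have "((\<lambda>t. v t - (U s + l * (s - t) + k * (W s + l * (s - t)) + (\<eta> + 5) * envelope t))
          has_real_derivative
          G s (u s) / a + l + k * l + (\<eta> + 5) * ((\<rho> / a) * (E - N * a))) (at s within {0..S})"
        by (rule derivative_eq_intros dv[OF sS] envelope_deriv refl)+ (simp add: E_def algebra_simps)
      then have "0 \<le> G s (u s) / a + l + k * l + (\<eta> + 5) * ((\<rho> / a) * (E - N * a))"
      proof (rule left_maximum_derivative_nonneg)
        fix r assume r: "r \<in> {0..<s}"
        show "v r - (U s + l * (s - r) + k * (W s + l * (s - r)) + (\<eta> + 5) * envelope r)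
            \<le> v s - (U s + l * (s - s) + k * (W s + l * (s - s)) + (\<eta> + 5) * envelope s)"
          using before[OF r] Wr[OF r] Ur[OF r] v_contact by (simp add: h_def E_def[symmetric])
      qed (use s in auto)
      then have "0 \<le> a * (G s (u s) / a + l + k * l + (\<eta> + 5) * ((\<rho> / a) * (E - N * a)))"
        using a by simp
      also have "\<dots> = G s (u s) + (1 + k) * l * a + (\<eta> + 5) * \<rho> * (E - N * a)"
        using a by (simp add: field_simps)
      finally have "0 \<le> G s (u s) + (1 + k) * l * a + (\<eta> + 5) * \<rho> * (E - N * a)" .
      moreover have "(1 + k) * l * a \<le> 2 * l * a"
        using k l a by (intro mult_right_mono) auto
      moreover have "G s (u s) \<le> G s q"
      proof -
        have "q \<le> u s" using v_contact hs(2) by (simp add: q_def algebra_simps)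
        then show ?thesis
          using drift[OF sS q(1) u_bound[OF sS]] \<gamma> mult_nonneg_nonneg[of \<gamma> "u s - q"] by linarith
      qed
      ultimately show False using contra by linarith
    next
      assume p_contact: "v s - u s - (k * W s + 5 * E) = 0"
      have "((\<lambda>t. v t - u t - (k * (W s + l * (s - t)) + 5 * envelope t)) has_real_derivative
          G s (u s) / a - (\<phi> ((v s - u s) / k) - u s) / (k * a) + k * l
          + 5 * ((\<rho> / a) * (E - N * a))) (at s within {0..S})"
        by (rule derivative_eq_intros dv[OF sS] du[OF sS] envelope_deriv refl)+
          (simp add: E_def algebra_simps)
      then have "0 \<le> G s (u s) / a - (\<phi> ((v s - u s) / k) - u s) / (k * a) + k * l
          + 5 * ((\<rho> / a) * (E - N * a))"
      proof (rule left_maximum_derivative_nonneg)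
        fix r assume r: "r \<in> {0..<s}"
        show "v r - u r - (k * (W s + l * (s - r)) + 5 * envelope r)
            \<le> v s - u s - (k * (W s + l * (s - s)) + 5 * envelope s)"
          using before[OF r] Wr[OF r] p_contact by (simp add: h_def E_def[symmetric])
      qed (use s in auto)
      then have "0 \<le> (k * a) * (G s (u s) / a - (\<phi> ((v s - u s) / k) - u s) / (k * a) + k * l
          + 5 * ((\<rho> / a) * (E - N * a)))"
        using a k by simp
      also have "\<dots> = k * G s (u s) + u s - \<phi> ((v s - u s) / k) + k * (k * l * a)
          + k * (5 * \<rho> * (E - N * a))"
        using a k by (simp add: field_simps)
      finally have ineq: "0 \<le> k * G s (u s) + u s - \<phi> ((v s - u s) / k) + k * (k * l * a)
          + k * (5 * \<rho> * (E - N * a))" .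
      have "q \<le> \<phi> ((v s - u s) / k)"
      proof -
        have "(v s - u s) / k = W s + 5 * E / k"
          using p_contact k by (simp add: field_simps)
        moreover have "E * k \<le> E * 1" using k E by (intro mult_left_mono) auto
        then have "E \<le> 5 * E / k" using k E by (simp add: field_simps)
        then have "\<eta> * E \<le> c * (5 * E / k)" using \<eta> E by (intro mult_mono) auto
        ultimately show ?thesis
          using \<phi>_above[OF sS, of "5 * E / k"] \<eta>E k E by (auto simp: q_def min_def split: if_splits)
      qed
      moreover have "k * G s (u s) + u s \<le> k * G s q + q"
      proof -
        have uq: "u s \<le> q" using p_contact hs(1) by (simp add: q_def algebra_simps)
        then have "G s (u s) - G s q \<le> \<Lambda> * (q - u s)"
          using drift[OF sS u_bound[OF sS] q(1)] by simp
        then have "k * (G s (u s) - G s q) \<le> (k * \<Lambda>) * (q - u s)"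
          using k(1) by (simp add: mult.assoc)
        also have "\<dots> \<le> 1 * (q - u s)" using k uq by (intro mult_right_mono) auto
        finally show ?thesis by (simp add: algebra_simps)
      qed
      ultimately have "0 \<le> k * (G s q + k * l * a + 5 * \<rho> * (E - N * a))"
        using ineq by (simp add: algebra_simps)
      then have "0 \<le> G s q + k * l * a + 5 * \<rho> * (E - N * a)"
        using k(1) by (simp add: zero_le_mult_iff)
      moreover have "k * l * a \<le> 2 * l * a" using k l a by (intro mult_right_mono) auto
      moreover have "5 * \<rho> * (E - N * a) \<le> (\<eta> + 5) * \<rho> * (E - N * a)"
        using \<eta> \<rho> E by (intro mult_right_mono) auto
      ultimately show False using contra by linarith
    qed
  qed
  then show "v t < U t + k * W t + (\<eta> + 5) * envelope t" "v t - u t < k * W t + 5 * envelope t"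
    by (auto simp: h_def)
qed

end

context fast_subsystem
begin

text \<open>
  The lower corner is the upper corner of the subsystem reflected in the origin.
\<close>

lemma reflected: "fast_subsystem S a k \<delta> \<gamma> \<Lambda> \<theta> c C l \<eta> \<rho> N
  (\<lambda>w. - \<phi> (- w)) (\<lambda>t. - v t) (\<lambda>t. - u t) (\<lambda>t. - U t) (\<lambda>t. - W t) (\<lambda>t p. - G t (- p))"
proof
  fix t assume t: "t \<in> {0..S}"
  show "((\<lambda>t. - v t) has_real_derivative - G t (- (- u t)) / a) (at t within {0..S})"
    using DERIV_minus[OF dv[OF t]] by simp
  have arg: "- ((- v t - - u t) / k) = (v t - u t) / k" by (simp add: minus_divide_left)
  show "((\<lambda>t. - u t) has_real_derivative (- \<phi> (- ((- v t - - u t) / k)) - - u t) / (k * a))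
      (at t within {0..S})"
    unfolding arg minus_diff_minus using DERIV_minus[OF du[OF t]] by (simp add: minus_divide_left)
  show "- U t + min (c * s) (\<theta> / 2) \<le> - \<phi> (- (- W t + s))" if "0 \<le> s" for s
    using \<phi>_below[OF t that] by simp
  show "- \<phi> (- (- W t - s)) \<le> - U t - min (c * s) (\<theta> / 2)" if "0 \<le> s" for s
    using \<phi>_above[OF t that] by (simp add: add.commute)
  show "\<gamma> * (q - p) \<le> - G t (- p) - - G t (- q) \<and> - G t (- p) - - G t (- q) \<le> \<Lambda> * (q - p)"
    if "\<bar>p\<bar> \<le> 1 + \<delta>" "\<bar>q\<bar> \<le> 1 + \<delta>" "p \<le> q" for p q
    using drift[OF t, of "- q" "- p"] that by simp
  show "\<bar>- U t - - U s\<bar> \<le> l * \<bar>t - s\<bar>" "\<bar>- W t - - W s\<bar> \<le> l * \<bar>t - s\<bar>" if "s \<in> {0..S}" for s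
    using U_lip[OF t that] W_lip[OF t that] by auto
qed (use a k \<gamma> \<delta> l C \<theta> \<eta> \<rho> N drift_U U_bound W_bound u_bound \<delta>1 init in auto)

lemma lower_barrier:
  assumes t: "t \<in> {0..S}"
  shows "U t + k * W t - (\<eta> + 5) * envelope t < v t" and "k * W t - 5 * envelope t < v t - u t"
  using fast_subsystem.upper_barrier[OF reflected t]
  unfolding fast_subsystem.envelope_def[OF reflected] envelope_def by auto

lemma output_bound:
  assumes t: "t \<in> {0..S}"
  shows "\<bar>v t\<bar> < 14"
proof -
  have "\<bar>k * W t\<bar> \<le> 1" using W_bound[OF t] k by (simp add: abs_mult mult_le_one)
  moreover have "(\<eta> + 5) * envelope t \<le> 6 * 2"
    using \<eta> \<theta> envelope_bounds[of t] t by (intro mult_mono) auto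
  ultimately show ?thesis
    using upper_barrier[OF t] lower_barrier[OF t] U_bound[OF t] \<eta> \<theta> by (auto simp: abs_less_iff)
qed

lemma control_error:
  assumes t: "t \<in> {0..S}"
  shows "\<bar>u t - U t\<bar> < 11 * envelope t"
proof -
  have "(\<eta> + 5) * envelope t \<le> 6 * envelope t"
    using \<eta> \<theta> envelope_bounds[of t] t by (intro mult_right_mono) auto
  then show ?thesis
    using upper_barrier[OF t] lower_barrier[OF t] unfolding abs_less_iff by linarith
qed

end

section \<open>Tracking of the sliding motion\<close>

text \<open>
  A bound that improves itself to a strict one persists, since there can be no first time at which it is attained.
\<close>

lemma confinement:
  fixes h :: "real \<Rightarrow> real"
  assumes cont: "continuous_on {0..T} h" and h0: "h 0 < 0"
    and improve: "\<And>s. s \<in> {0..T} \<Longrightarrow> (\<And>t. t \<in> {0..s} \<Longrightarrow> h t \<le> 0) \<Longrightarrow> h s < 0"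
    and t: "t \<in> {0..T}"
  shows "h t < 0"
proof (rule ccontr)
  assume "\<not> h t < 0"
  then obtain s where s: "0 < s" "s \<le> T" "h s = 0" and before: "\<And>r. r \<in> {0..<s} \<Longrightarrow> h r < 0"
    using first_contact[OF cont h0 t] by auto
  have "h s < 0"
  proof (rule improve)
    show "h r \<le> 0" if "r \<in> {0..s}" for r
      using s before[of r] that by (cases "r = s") auto
  qed (use s in auto)
  then show False using s by simp
qed

text \<open>
  What the estimates use about the vector field, with explicit constants, on the compact region
  \<open>\<bar>x\<bar> \<le> M\<close>, \<open>\<bar>y\<bar> \<le> \<delta>\<close>, \<open>\<bar>u\<bar> \<le> 1 + \<delta>\<close>. The margin \<open>\<delta>\<close> beyond the control range \<open>[-1, 1]\<close> accommodates the
  initial values of \<open>u\<close>, and \<open>\<theta>\<close> keeps the equivalent control away from the saturated values, where \<open>\<phi>\<close> is flat.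
\<close>

locale sliding_region =
  fixes f :: "'a::euclidean_space \<Rightarrow> real \<Rightarrow> real \<Rightarrow> 'a" and g :: "'a \<Rightarrow> real \<Rightarrow> real \<Rightarrow> real"
    and \<phi> \<psi> :: "real \<Rightarrow> real" and U :: "'a \<Rightarrow> real"
    and M \<delta> \<Lambda> B \<gamma> \<theta> c :: real
  assumes \<phi>: "regularizing_function \<phi>" and \<delta>: "0 < \<delta>" "\<delta> \<le> 1" and \<Lambda>: "0 \<le> \<Lambda>" and B: "0 \<le> B"
    and \<gamma>: "0 < \<gamma>" and \<theta>: "0 < \<theta>" "\<theta> \<le> 1" and c: "0 < c"
    and f_lip: "\<And>x x' y y' u u'. norm x \<le> M \<Longrightarrow> norm x' \<le> M \<Longrightarrow> \<bar>y\<bar> \<le> \<delta> \<Longrightarrow> \<bar>y'\<bar> \<le> \<delta> \<Longrightarrow>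
      \<bar>u\<bar> \<le> 1 + \<delta> \<Longrightarrow> \<bar>u'\<bar> \<le> 1 + \<delta> \<Longrightarrow>
      norm (f x y u - f x' y' u') \<le> \<Lambda> * (norm (x - x') + \<bar>y - y'\<bar> + \<bar>u - u'\<bar>)"
    and g_lip: "\<And>x x' y y' u u'. norm x \<le> M \<Longrightarrow> norm x' \<le> M \<Longrightarrow> \<bar>y\<bar> \<le> \<delta> \<Longrightarrow> \<bar>y'\<bar> \<le> \<delta> \<Longrightarrow>
      \<bar>u\<bar> \<le> 1 + \<delta> \<Longrightarrow> \<bar>u'\<bar> \<le> 1 + \<delta> \<Longrightarrow>
      \<bar>g x y u - g x' y' u'\<bar> \<le> \<Lambda> * (norm (x - x') + \<bar>y - y'\<bar> + \<bar>u - u'\<bar>)"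
    and f_bound: "\<And>x y u. norm x \<le> M \<Longrightarrow> \<bar>y\<bar> \<le> \<delta> \<Longrightarrow> \<bar>u\<bar> \<le> 1 + \<delta> \<Longrightarrow> norm (f x y u) \<le> B"
    and g_decreasing: "\<And>x y p q. norm x \<le> M \<Longrightarrow> \<bar>y\<bar> \<le> \<delta> \<Longrightarrow> \<bar>p\<bar> \<le> 1 + \<delta> \<Longrightarrow> \<bar>q\<bar> \<le> 1 + \<delta> \<Longrightarrow>
      p \<le> q \<Longrightarrow> \<gamma> * (q - p) \<le> g x y p - g x y q"
    and U_bound: "\<And>x. norm x \<le> M \<Longrightarrow> \<bar>U x\<bar> \<le> 1 - \<theta>"
    and U_zero: "\<And>x. norm x \<le> M \<Longrightarrow> g x 0 (U x) = 0"
    and \<psi>_bound: "\<And>p. \<bar>p\<bar> \<le> 1 - \<theta> \<Longrightarrow> \<bar>\<psi> p\<bar> \<le> 1"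
    and \<psi>_lip: "\<And>p q. \<bar>p\<bar> \<le> 1 - \<theta> \<Longrightarrow> \<bar>q\<bar> \<le> 1 - \<theta> \<Longrightarrow> \<bar>\<psi> p - \<psi> q\<bar> \<le> \<bar>p - q\<bar> / c"
    and \<phi>_above: "\<And>p s. \<bar>p\<bar> \<le> 1 - \<theta> \<Longrightarrow> 0 \<le> s \<Longrightarrow> p + min (c * s) (\<theta> / 2) \<le> \<phi> (\<psi> p + s)"
    and \<phi>_below: "\<And>p s. \<bar>p\<bar> \<le> 1 - \<theta> \<Longrightarrow> 0 \<le> s \<Longrightarrow> \<phi> (\<psi> p - s) \<le> p - min (c * s) (\<theta> / 2)"
begin

lemma U_bound': "norm x \<le> M \<Longrightarrow> \<bar>U x\<bar> \<le> 1 + \<delta>"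
  using U_bound[of x] \<theta> \<delta> by linarith

lemma U_lip:
  assumes "norm x \<le> M" "norm x' \<le> M"
  shows "\<bar>U x - U x'\<bar> \<le> \<Lambda> / \<gamma> * norm (x - x')"
proof -
  have "\<gamma> * \<bar>U x - U x'\<bar> \<le> \<bar>g x 0 (U x) - g x 0 (U x')\<bar>"
    using g_decreasing[OF assms(1), of 0 "U x" "U x'"] g_decreasing[OF assms(1), of 0 "U x'" "U x"]
      U_bound'[OF assms(1)] U_bound'[OF assms(2)] \<delta>
    by (cases "U x \<le> U x'") auto
  also have "\<dots> = \<bar>g x' 0 (U x') - g x 0 (U x')\<bar>"
    using U_zero assms by simp
  also have "\<dots> \<le> \<Lambda> * norm (x - x')"
    using g_lip[OF assms(2) assms(1), of 0 0 "U x'" "U x'"] U_bound'[OF assms(2)] \<delta>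
    by (simp add: norm_minus_commute)
  finally show ?thesis using \<gamma> by (simp add: field_simps)
qed

text \<open>
  The constants below are fixed by the region alone, hence before \<open>a\<close> and \<open>k\<close>. The speed bounds the Lipschitz
  constants in time of both \<open>U (x t)\<close> and \<open>\<psi> (U (x t))\<close>. The fast constants \<open>\<eta>\<close>, \<open>\<rho>\<close>, \<open>N\<close> solve the inequalities
  required of the corner, and \<open>A\<close>, \<open>K\<close> are the exponential rate and the prefactor in the Gronwall estimate for \<open>x - x\<^sub>U\<close>.
\<close>

definition "speed = \<Lambda> / \<gamma> * B * (1 + 1 / c)"
definition "\<eta> = min c (\<theta> / 4)"
definition "\<rho> = \<gamma> * \<eta> / (2 * (\<eta> + 5))"
definition "N = 2 * (14 * \<Lambda> + 2 * speed) / (\<gamma> * \<eta>)"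
definition "A = \<Lambda> * (1 + \<Lambda> / \<gamma>)"
definition "K = \<Lambda> * (14 + 11 * N) + 11 * \<Lambda> / \<rho> + 1"

lemma \<eta>: "0 < \<eta>" "\<eta> \<le> c" "\<eta> \<le> \<theta> / 4"
  using c \<theta> by (auto simp: \<eta>_def)

lemma \<rho>: "0 < \<rho>" "\<rho> * (\<eta> + 5) \<le> \<gamma> * \<eta> / 2"
  using \<gamma> \<eta> by (auto simp: \<rho>_def field_simps)

lemma speed_nonneg: "0 \<le> speed"
  using \<Lambda> \<gamma> B c by (simp add: speed_def)

lemma N_nonneg: "0 \<le> N"
  using \<Lambda> \<gamma> \<eta> speed_nonneg by (simp add: N_def)

lemma A_nonneg: "0 \<le> A"
  using \<Lambda> \<gamma> by (simp add: A_def)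

lemma K_pos: "0 < K"
  using \<Lambda> \<rho> N_nonneg by (simp add: K_def add_nonneg_pos)

text \<open>
  The deviation \<open>x - x\<^sub>U\<close> grows at most at rate \<open>A\<close>, with a forcing of order \<open>a + exp (-\<rho> t / a)\<close>. Up to the
  factor \<open>exp (A t)\<close>, the barrier \<open>b\<close> is \<open>a K (1 + t)\<close> plus an antiderivative of the exponential forcing.
  The latter is of order \<open>a\<close>, so the initial layer costs no more than the slow drift.
\<close>

lemma tracking_in_region:
  assumes sol: "regularized_solution f g \<phi> (k * a) (- a) S x y u"
    and a: "0 < a" "14 * a \<le> \<delta>" "N * a \<le> 1" and k: "0 < k" "k \<le> 1" "k * \<Lambda> \<le> 1"
    and init: "x 0 = xU 0" "\<bar>y 0\<bar> < a" "\<bar>u 0\<bar> < 1 + \<delta>"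
    and region: "\<And>t. t \<in> {0..S} \<Longrightarrow> norm (x t) \<le> M \<and> \<bar>y t\<bar> \<le> 14 * a"
    and xU: "\<And>t. t \<in> {0..S} \<Longrightarrow> (xU has_vector_derivative f (xU t) 0 (U (xU t))) (at t within {0..S})"
    and xU_bound: "\<And>t. t \<in> {0..S} \<Longrightarrow> norm (xU t) \<le> M"
    and t: "t \<in> {0..S}"
  shows "\<bar>u t\<bar> < 1 + \<delta>" and "\<bar>y t\<bar> < 14 * a"
    and "norm (x t - xU t) < K * (1 + S) * exp (A * S) * a"
proof -
  have dx: "(x has_vector_derivative f (x t) (y t) (u t)) (at t within {0..S})"
    and dy: "(y has_real_derivative g (x t) (y t) (u t)) (at t within {0..S})"
    and du: "(u has_real_derivative (\<phi> ((y t / a - u t) / k) - u t) / (k * a)) (at t within {0..S})"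
    if t: "t \<in> {0..S}" for t
  proof -
    show "(x has_vector_derivative f (x t) (y t) (u t)) (at t within {0..S})"
      "(y has_real_derivative g (x t) (y t) (u t)) (at t within {0..S})"
      using sol t unfolding regularized_solution_def by auto
    obtain u' where u': "(u has_real_derivative u') (at t within {0..S})"
      "(k * a) * u' = \<phi> ((y t + (- a) * u t) / (k * a)) - u t"
      using sol t unfolding regularized_solution_def by blast
    have "(y t + (- a) * u t) / (k * a) = (y t / a - u t) / k"
      using a k by (simp add: field_simps)
    then have "u' = (\<phi> ((y t / a - u t) / k) - u t) / (k * a)"
      using u'(2) a k by (simp add: field_simps)
    then show "(u has_real_derivative (\<phi> ((y t / a - u t) / k) - u t) / (k * a)) (at t within {0..S})"
      using u'(1) by simp
  qed
  have ka: "0 < k * a" using k a by simp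
  have u_bound: "\<bar>u t\<bar> < 1 + \<delta>" if t: "t \<in> {0..S}" for t
  proof -
    have "u t < 1 + \<delta>"
    proof (rule scalar_barrier[OF du DERIV_const _ _ t])
      fix t assume "u t = 1 + \<delta>"
      then have "\<phi> ((y t / a - u t) / k) - u t < 0"
        using regularizing_function_bound[OF \<phi>, of "(y t / a - u t) / k"] \<delta> by (auto simp: abs_le_iff)
      then show "(\<phi> ((y t / a - u t) / k) - u t) / (k * a) < 0"
        using ka by (rule divide_neg_pos)
    qed (use init in auto)
    moreover have "- u t < 1 + \<delta>"
    proof (rule scalar_barrier[OF DERIV_minus[OF du] DERIV_const _ _ t])
      fix t assume "- u t = 1 + \<delta>"
      then have "0 < \<phi> ((y t / a - u t) / k) - u t"
        using regularizing_function_bound[OF \<phi>, of "(y t / a - u t) / k"] \<delta> by (auto simp: abs_le_iff)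
      then show "- ((\<phi> ((y t / a - u t) / k) - u t) / (k * a)) < 0"
        using ka by simp
    qed (use init in auto)
    ultimately show ?thesis by (simp add: abs_less_iff)
  qed
  have yb: "\<bar>y t\<bar> \<le> \<delta>" if "t \<in> {0..S}" for t using region[OF that] a by linarith
  have ub: "\<bar>u t\<bar> \<le> 1 + \<delta>" if "t \<in> {0..S}" for t using u_bound[OF that] by simp
  have xb: "norm (x t) \<le> M" if "t \<in> {0..S}" for t using region[OF that] by simp
  have x_lip: "norm (x t - x s) \<le> B * \<bar>t - s\<bar>" if "t \<in> {0..S}" "s \<in> {0..S}" for t s
  proof -
    have "norm (x t - x s) \<le> B * norm (t - s)"
    proof (rule differentiable_bound[of "{0..S}" x "\<lambda>t h. h *\<^sub>R f (x t) (y t) (u t)"])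
      fix t assume t: "t \<in> {0..S}"
      show "(x has_derivative (\<lambda>h. h *\<^sub>R f (x t) (y t) (u t))) (at t within {0..S})"
        using dx[OF t] by (simp add: has_vector_derivative_def)
      show "onorm (\<lambda>h. h *\<^sub>R f (x t) (y t) (u t)) \<le> B"
      proof (rule onorm_le)
        fix h :: real
        show "norm (h *\<^sub>R f (x t) (y t) (u t)) \<le> B * norm h"
          using mult_right_mono[OF f_bound[OF xb[OF t] yb[OF t] ub[OF t]], of "\<bar>h\<bar>"]
          by (simp add: mult.commute)
      qed
    qed (use that in auto)
    then show ?thesis by simp
  qed
  have base: "\<Lambda> / \<gamma> * B \<le> speed" "\<Lambda> / \<gamma> * B / c \<le> speed"
    using \<Lambda> \<gamma> B c by (auto simp: speed_def distrib_left)
  have Ux_lip: "\<bar>U (x t) - U (x s)\<bar> \<le> \<Lambda> / \<gamma> * B * \<bar>t - s\<bar>"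
    if "t \<in> {0..S}" "s \<in> {0..S}" for t s
  proof -
    have "\<bar>U (x t) - U (x s)\<bar> \<le> \<Lambda> / \<gamma> * norm (x t - x s)"
      by (rule U_lip) (use xb that in auto)
    also have "\<dots> \<le> \<Lambda> / \<gamma> * (B * \<bar>t - s\<bar>)"
      using x_lip[OF that] \<Lambda> \<gamma> by (intro mult_left_mono) auto
    finally show ?thesis by (simp add: mult.assoc)
  qed
  interpret fast: fast_subsystem S a k \<delta> \<gamma> \<Lambda> \<theta> c "14 * \<Lambda>" speed \<eta> \<rho> N \<phi>
    "\<lambda>t. y t / a" u "\<lambda>t. U (x t)" "\<lambda>t. \<psi> (U (x t))" "\<lambda>t p. g (x t) (y t) p"
  proof
    fix t assume t: "t \<in> {0..S}"
    show "((\<lambda>t. y t / a) has_real_derivative g (x t) (y t) (u t) / a) (at t within {0..S})"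
      by (rule DERIV_cdivide[OF dy[OF t]])
    show "(u has_real_derivative (\<phi> ((y t / a - u t) / k) - u t) / (k * a)) (at t within {0..S})"
      by (rule du[OF t])
    show "\<gamma> * (q - p) \<le> g (x t) (y t) p - g (x t) (y t) q \<and>
        g (x t) (y t) p - g (x t) (y t) q \<le> \<Lambda> * (q - p)"
      if "\<bar>p\<bar> \<le> 1 + \<delta>" "\<bar>q\<bar> \<le> 1 + \<delta>" "p \<le> q" for p q
      using g_decreasing[OF xb[OF t] yb[OF t] that] that
        g_lip[OF xb[OF t] xb[OF t] yb[OF t] yb[OF t] that(1,2)] by auto
    have "\<bar>g (x t) (y t) (U (x t)) - g (x t) 0 (U (x t))\<bar> \<le> \<Lambda> * \<bar>y t\<bar>"
      using g_lip[OF xb[OF t] xb[OF t] yb[OF t], of 0 "U (x t)" "U (x t)"] U_bound'[OF xb[OF t]] \<delta>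
      by simp
    also have "\<dots> \<le> \<Lambda> * (14 * a)" using region[OF t] \<Lambda> by (intro mult_left_mono) auto
    finally show "\<bar>g (x t) (y t) (U (x t))\<bar> \<le> 14 * \<Lambda> * a"
      using U_zero[OF xb[OF t]] by simp
    show "\<bar>U (x t)\<bar> \<le> 1 - \<theta>" by (rule U_bound[OF xb[OF t]])
    then show "\<bar>\<psi> (U (x t))\<bar> \<le> 1" by (rule \<psi>_bound)
    show "U (x t) + min (c * s) (\<theta> / 2) \<le> \<phi> (\<psi> (U (x t)) + s)"
      "\<phi> (\<psi> (U (x t)) - s) \<le> U (x t) - min (c * s) (\<theta> / 2)" if "0 \<le> s" for s
      using \<phi>_above[OF U_bound[OF xb[OF t]] that] \<phi>_below[OF U_bound[OF xb[OF t]] that] by auto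
    show "\<bar>u t\<bar> \<le> 1 + \<delta>" by (rule ub[OF t])
    fix s assume s: "s \<in> {0..S}"
    have "\<Lambda> / \<gamma> * B * \<bar>t - s\<bar> \<le> speed * \<bar>t - s\<bar>"
      using base by (intro mult_right_mono) auto
    then show "\<bar>U (x t) - U (x s)\<bar> \<le> speed * \<bar>t - s\<bar>"
      using Ux_lip[OF t s] by linarith
    have "\<bar>\<psi> (U (x t)) - \<psi> (U (x s))\<bar> \<le> \<bar>U (x t) - U (x s)\<bar> / c"
      by (rule \<psi>_lip) (use U_bound xb t s in auto)
    also have "\<dots> \<le> \<Lambda> / \<gamma> * B * \<bar>t - s\<bar> / c"
      using Ux_lip[OF t s] c by (intro divide_right_mono) auto
    also have "\<dots> = \<Lambda> / \<gamma> * B / c * \<bar>t - s\<bar>" by simp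
    also have "\<dots> \<le> speed * \<bar>t - s\<bar>"
      using base by (intro mult_right_mono) auto
    finally show "\<bar>\<psi> (U (x t)) - \<psi> (U (x s))\<bar> \<le> speed * \<bar>t - s\<bar>" .
  next
    show "14 * \<Lambda> + 2 * speed \<le> \<gamma> * \<eta> / 2 * N"
      using \<gamma> \<eta> by (simp add: N_def)
    show "\<bar>y 0 / a\<bar> < 1" using init(2) a(1) by simp
  qed (use a k \<gamma> \<delta> \<Lambda> \<theta> \<eta> \<rho> speed_nonneg in auto)
  show "\<bar>u t\<bar> < 1 + \<delta>" by (rule u_bound[OF t])
  show "\<bar>y t\<bar> < 14 * a" using fast.output_bound[OF t] a by (simp add: abs_if field_simps split: if_splits)

  define E where "E t = exp (- (\<rho> / a) * t)" for t
  define b where "b t = a * exp (A * t) * (K * (1 + t) - 11 * \<Lambda> / \<rho> * E t)" for t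
  have E1: "0 < E t" "E t \<le> 1" if "t \<in> {0..S}" for t
    using that \<rho> a by (auto simp: E_def)
  have gap: "\<Lambda> * (14 + 11 * N) + 1 \<le> K * (1 + t) - 11 * \<Lambda> / \<rho> * E t" if t: "t \<in> {0..S}" for t
  proof -
    have "11 * \<Lambda> / \<rho> * E t \<le> 11 * \<Lambda> / \<rho> * 1"
      using E1[OF t] \<Lambda> \<rho> by (intro mult_left_mono) auto
    moreover have "0 \<le> K * t" using K_pos t by simp
    ultimately show ?thesis by (simp add: distrib_left K_def)
  qed
  have gap0: "0 \<le> \<Lambda> * (14 + 11 * N)" using \<Lambda> N_nonneg by simp
  have zt: "norm (x t - xU t) < b t"
  proof (rule norm_barrier[where S = S and z = "\<lambda>t. x t - xU t" and
        z' = "\<lambda>t. f (x t) (y t) (u t) - f (xU t) 0 (U (xU t))" and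
        b' = "\<lambda>t. A * b t + a * exp (A * t) * (K + 11 * \<Lambda> / a * E t)"])
    fix t assume t: "t \<in> {0..S}"
    show "((\<lambda>t. x t - xU t) has_vector_derivative f (x t) (y t) (u t) - f (xU t) 0 (U (xU t)))
        (at t within {0..S})"
      by (rule has_vector_derivative_diff[OF dx[OF t] xU[OF t]])
    have dE: "(E has_real_derivative - (\<rho> / a) * E t) (at t within {0..S})"
      unfolding E_def using a by (auto intro!: derivative_eq_intros)
    show "(b has_real_derivative A * b t + a * exp (A * t) * (K + 11 * \<Lambda> / a * E t))
        (at t within {0..S})"
      unfolding b_def by (rule derivative_eq_intros dE refl)+ (use a \<rho> in \<open>simp add: field_simps\<close>)
    show "0 < b t"
      unfolding b_def using a gap[OF t] gap0 by (intro mult_pos_pos) auto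
    assume contact: "norm (x t - xU t) = b t"
    have u_err: "\<bar>u t - U (x t)\<bar> \<le> 11 * (E t + N * a)"
      using fast.control_error[OF t] by (simp add: fast.envelope_def E_def)
    have "\<bar>u t - U (xU t)\<bar> \<le> 11 * (E t + N * a) + \<Lambda> / \<gamma> * b t"
      using u_err U_lip[OF xb[OF t] xU_bound[OF t]] contact by simp
    then have "norm (x t - xU t) + \<bar>y t - 0\<bar> + \<bar>u t - U (xU t)\<bar>
        \<le> b t + 14 * a + (11 * (E t + N * a) + \<Lambda> / \<gamma> * b t)"
      using contact region[OF t] by simp
    then have "norm (f (x t) (y t) (u t) - f (xU t) 0 (U (xU t)))
        \<le> \<Lambda> * (b t + 14 * a + (11 * (E t + N * a) + \<Lambda> / \<gamma> * b t))"
      using f_lip[OF xb[OF t] xU_bound[OF t] yb[OF t], of 0 "u t" "U (xU t)"] \<delta> ub[OF t]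
        U_bound'[OF xU_bound[OF t]] mult_left_mono[OF _ \<Lambda>] by (smt (verit) abs_zero)
    also have "\<dots> = A * b t + (\<Lambda> * (14 + 11 * N) * a + 11 * \<Lambda> * E t)"
      by (simp add: A_def algebra_simps)
    also have "\<dots> < A * b t + a * exp (A * t) * (K + 11 * \<Lambda> / a * E t)"
    proof -
      have "\<Lambda> * (14 + 11 * N) < K" using \<Lambda> \<rho> by (simp add: K_def add_nonneg_pos)
      then have "\<Lambda> * (14 + 11 * N) * a < K * a"
        using a(1) by (rule mult_strict_right_mono)
      moreover have "K * a + 11 * \<Lambda> * E t = a * (K + 11 * \<Lambda> / a * E t)"
        using a by (simp add: field_simps)
      ultimately have "\<Lambda> * (14 + 11 * N) * a + 11 * \<Lambda> * E t < a * (K + 11 * \<Lambda> / a * E t)"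
        by linarith
      also have "\<dots> \<le> exp (A * t) * (a * (K + 11 * \<Lambda> / a * E t))"
      proof -
        have "1 \<le> exp (A * t)" using A_nonneg t by simp
        moreover have "0 \<le> a * (K + 11 * \<Lambda> / a * E t)" using a K_pos \<Lambda> E1[OF t] by simp
        ultimately show ?thesis using mult_right_mono by fastforce
      qed
      finally show ?thesis by (simp add: ac_simps)
    qed
    finally show "norm (f (x t) (y t) (u t) - f (xU t) 0 (U (xU t)))
        < A * b t + a * exp (A * t) * (K + 11 * \<Lambda> / a * E t)" .
  next
    have "0 \<in> {0..S}" using t by auto
    from gap[OF this] show "norm (x 0 - xU 0) < b 0"
      using init a gap0 by (simp add: b_def)
  qed (rule t)
  also have "b t \<le> a * exp (A * S) * (K * (1 + S))"
    unfolding b_def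
  proof (intro mult_mono)
    show "exp (A * t) \<le> exp (A * S)" using t A_nonneg by (simp add: mult_left_mono)
    have "0 \<le> 11 * \<Lambda> / \<rho> * E t" using \<Lambda> \<rho> E1[OF t] by simp
    moreover have "K * (1 + t) \<le> K * (1 + S)" using t K_pos by (intro mult_left_mono) auto
    ultimately show "K * (1 + t) - 11 * \<Lambda> / \<rho> * E t \<le> K * (1 + S)" by linarith
    show "0 \<le> K * (1 + t) - 11 * \<Lambda> / \<rho> * E t" using gap[OF t] gap0 by linarith
  qed (use a in auto)
  finally show "norm (x t - xU t) < K * (1 + S) * exp (A * S) * a" by (simp add: ac_simps)
qed

text \<open>
  The assumption on the trajectory is deliberately local: it has to solve the system only up to times
  before which it stays in the region. Genuine solutions satisfy it trivially, and so do
  solutions of the truncated system, for which the lemma shows that the truncation is never active.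
\<close>

lemma tracking:
  assumes local_sol: "\<And>S. S \<in> {0..T} \<Longrightarrow>
      (\<And>t. t \<in> {0..S} \<Longrightarrow> norm (x t) \<le> M \<and> \<bar>y t\<bar> \<le> 14 * a \<and> \<bar>u t\<bar> \<le> 1 + \<delta>) \<Longrightarrow>
      regularized_solution f g \<phi> (k * a) (- a) S x y u"
    and cont: "continuous_on {0..T} x" "continuous_on {0..T} y" "continuous_on {0..T} u"
    and a: "0 < a" "14 * a \<le> \<delta>" "N * a \<le> 1" and k: "0 < k" "k \<le> 1" "k * \<Lambda> \<le> 1"
    and init: "x 0 = xU 0" "\<bar>y 0\<bar> < a" "\<bar>u 0\<bar> < 1 + \<delta>"
    and xU: "\<And>t. t \<in> {0..T} \<Longrightarrow> (xU has_vector_derivative f (xU t) 0 (U (xU t))) (at t within {0..T})"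
    and room: "\<And>t. t \<in> {0..T} \<Longrightarrow> norm (xU t) + K * (1 + T) * exp (A * T) * a \<le> M"
    and t: "t \<in> {0..T}"
  shows "norm (x t) \<le> M" and "\<bar>u t\<bar> \<le> 1 + \<delta>" and "\<bar>y t\<bar> < 14 * a"
    and "norm (x t - xU t) < K * (1 + T) * exp (A * T) * a"
    and "regularized_solution f g \<phi> (k * a) (- a) T x y u"
proof -
  have T: "0 \<le> T" "0 \<in> {0..T}" "T \<in> {0..T}" using t by auto
  let ?D = "K * (1 + T) * exp (A * T) * a"
  have D: "0 < ?D" using K_pos T a by simp
  define h where "h t = max (norm (x t) - M) (max (\<bar>y t\<bar> - 14 * a) (\<bar>u t\<bar> - (1 + \<delta>)))" for t
  have estimates: "\<bar>u t\<bar> < 1 + \<delta> \<and> \<bar>y t\<bar> < 14 * a \<and> norm (x t - xU t) < ?D"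
    if S: "S \<in> {0..T}" and neg: "\<And>t. t \<in> {0..S} \<Longrightarrow> h t \<le> 0" and t: "t \<in> {0..S}" for S t
  proof -
    have region: "norm (x t) \<le> M \<and> \<bar>y t\<bar> \<le> 14 * a \<and> \<bar>u t\<bar> \<le> 1 + \<delta>" if "t \<in> {0..S}" for t
      using neg[OF that] by (simp add: h_def)
    have sol: "regularized_solution f g \<phi> (k * a) (- a) S x y u"
      by (rule local_sol[OF S region])
    have xU': "(xU has_vector_derivative f (xU t) 0 (U (xU t))) (at t within {0..S})"
      if "t \<in> {0..S}" for t
      by (rule has_vector_derivative_within_subset[OF xU]) (use that S in auto)
    have xUb: "norm (xU t) \<le> M" if "t \<in> {0..S}" for t
      using room[of t] D that S by auto
    note * = tracking_in_region[OF sol a k init _ xU' xUb t]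
    have "K * (1 + S) * exp (A * S) * a \<le> ?D"
      using S K_pos A_nonneg a by (intro mult_right_mono mult_mono) (auto intro: mult_left_mono)
    moreover have "norm (x t - xU t) < K * (1 + S) * exp (A * S) * a"
      by (rule *(3)) (use region in auto)
    ultimately show ?thesis using *(1,2) region by auto
  qed
  have neg: "h s < 0" if "s \<in> {0..T}" for s
  proof (rule confinement[OF _ _ _ that])
    show "continuous_on {0..T} h"
      unfolding h_def by (intro continuous_intros cont)
    show "h 0 < 0" using init room[OF T(2)] D a by (auto simp: h_def)
    fix s assume s: "s \<in> {0..T}" and "\<And>t. t \<in> {0..s} \<Longrightarrow> h t \<le> 0"
    then have "\<bar>u s\<bar> < 1 + \<delta> \<and> \<bar>y s\<bar> < 14 * a \<and> norm (x s - xU s) < ?D"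
      using estimates[of s s] by auto
    moreover have "norm (x s) \<le> norm (xU s) + norm (x s - xU s)"
      using norm_triangle_ineq[of "xU s" "x s - xU s"] by simp
    ultimately show "h s < 0" using room[OF s] by (auto simp: h_def)
  qed
  show "norm (x t) \<le> M" "\<bar>u t\<bar> \<le> 1 + \<delta>" using neg[OF t] by (auto simp: h_def)
  show "\<bar>y t\<bar> < 14 * a" "norm (x t - xU t) < ?D"
    using estimates[OF T(3) less_imp_le[OF neg] t] by auto
  show "regularized_solution f g \<phi> (k * a) (- a) T x y u"
    by (rule local_sol[OF T(3)]) (use neg in \<open>force simp: h_def\<close>)
qed

end

section \<open>Existence of the regularized solution\<close>

lemma regularized_solution_restrict:
  assumes sol: "regularized_solution f g \<phi> \<epsilon> \<alpha> T x y u" and S: "S \<le> T"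
  shows "regularized_solution f g \<phi> \<epsilon> \<alpha> S x y u"
  unfolding regularized_solution_def
proof (intro ballI conjI)
  fix t assume "t \<in> {0..S}"
  then have t: "t \<in> {0..T}" and sub: "{0..S} \<subseteq> {0..T}" using S by auto
  note sol = sol[unfolded regularized_solution_def, rule_format, OF t]
  show "(x has_vector_derivative f (x t) (y t) (u t)) (at t within {0..S})"
    using sol sub has_vector_derivative_within_subset by blast
  show "(y has_real_derivative g (x t) (y t) (u t)) (at t within {0..S})"
    using sol sub DERIV_subset by blast
  show "\<exists>u'. (u has_real_derivative u') (at t within {0..S}) \<and>
      \<epsilon> * u' = \<phi> ((y t + \<alpha> * u t) / \<epsilon>) - u t"
    using sol sub DERIV_subset by blast
qed

lemma regularized_solution_continuous:
  assumes sol: "regularized_solution f g \<phi> \<epsilon> \<alpha> T x y u"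
  shows "continuous_on {0..T} x" and "continuous_on {0..T} y" and "continuous_on {0..T} u"
proof -
  note sol = sol[unfolded regularized_solution_def, rule_format]
  show "continuous_on {0..T} x"
    unfolding continuous_on_eq_continuous_within
    using sol has_vector_derivative_continuous by blast
  show "continuous_on {0..T} y" "continuous_on {0..T} u"
    unfolding continuous_on_eq_continuous_within
    using sol DERIV_continuous by blast+
qed

lemma regularized_solution_until_exit:
  fixes f :: "'a::euclidean_space \<Rightarrow> real \<Rightarrow> real \<Rightarrow> 'a" and g :: "'a \<Rightarrow> real \<Rightarrow> real \<Rightarrow> real"
  assumes f: "Ck (Suc 0) (\<lambda>(x, y, u). f x y u)" and g: "Ck (Suc 0) (\<lambda>(x, y, u). g x y u)"
    and \<phi>: "Ck (Suc 0) \<phi>" and \<epsilon>: "0 < \<epsilon>" and T: "0 \<le> T"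
    and M: "0 \<le> M1" "0 \<le> M2" "0 \<le> M3"
  obtains x y u where "x 0 = x_init" "y 0 = y_init" "u 0 = u_init"
    "continuous_on {0..T} x" "continuous_on {0..T} y" "continuous_on {0..T} u"
    "\<And>S. S \<in> {0..T} \<Longrightarrow>
      (\<And>t. t \<in> {0..S} \<Longrightarrow> norm (x t) \<le> M1 \<and> \<bar>y t\<bar> \<le> M2 \<and> \<bar>u t\<bar> \<le> M3) \<Longrightarrow>
      regularized_solution f g \<phi> \<epsilon> \<alpha> S x y u"
proof -
  define Q where "Q = cball (0::'a) M1 \<times> (cball (0::real) M2 \<times> cball (0::real) M3)"
  have Q: "compact Q" "convex Q" "Q \<noteq> {}"
    using M by (auto simp: Q_def intro!: compact_Times convex_Times)
  define w where "w = (\<lambda>z::'a \<times> real \<times> real. (fst (snd z) + \<alpha> * snd (snd z)) / \<epsilon>)"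
  have w: "bounded_linear w"
    unfolding w_def
    by (intro bounded_linear_divide[THEN bounded_linear_compose] bounded_linear_add
        bounded_linear_const_mult bounded_linear_fst_comp bounded_linear_snd_comp
        bounded_linear_fst bounded_linear_snd
        bounded_linear_compose[OF bounded_linear_fst bounded_linear_snd]
        bounded_linear_compose[OF bounded_linear_snd bounded_linear_snd])
  obtain Lf where Lf: "Lf-lipschitz_on Q (\<lambda>(x, y, u). f x y u)"
    using C1_lipschitz_on_compact_convex[OF f Q(1,2)] by blast
  obtain Lg where Lg: "Lg-lipschitz_on Q (\<lambda>(x, y, u). g x y u)"
    using C1_lipschitz_on_compact_convex[OF g Q(1,2)] by blast
  obtain Lw where Lw: "Lw-lipschitz_on Q w"
    using bounded_linear.lipschitz_boundE[OF w] by blast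
  have "compact (w ` Q)" "convex (w ` Q)"
    using Q w by (auto intro: compact_continuous_image linear_continuous_on convex_linear_image
        bounded_linear.linear)
  then obtain L\<phi> where L\<phi>: "L\<phi>-lipschitz_on (w ` Q) \<phi>"
    using C1_lipschitz_on_compact_convex[OF \<phi>] by blast
  obtain Lu where Lu: "Lu-lipschitz_on Q (\<lambda>z. snd (snd z))"
    using bounded_linear.lipschitz_boundE[OF bounded_linear_compose[OF bounded_linear_snd bounded_linear_snd]]
    by blast
  define F where "F z = ((\<lambda>(x, y, u). f x y u) z, (\<lambda>(x, y, u). g x y u) z,
      (1 / \<epsilon>) * (\<phi> (w z) - snd (snd z)))" for z
  have "\<exists>L. L-lipschitz_on Q F"
    unfolding F_def
    using lipschitz_on_Pair[OF Lf lipschitz_on_Pair[OF Lg lipschitz_on_cmult_real[OF lipschitz_on_diff[OF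
      lipschitz_on_compose2[OF Lw L\<phi>] Lu], of "1 / \<epsilon>"]]] by blast
  then obtain L where L: "L-lipschitz_on Q F" by blast
  obtain X where X: "X 0 = (x_init, y_init, u_init)" "continuous_on {0..T} X"
    and sol: "\<And>S t. S \<in> {0..T} \<Longrightarrow> (\<And>t. t \<in> {0..S} \<Longrightarrow> X t \<in> Q) \<Longrightarrow> t \<in> {0..S} \<Longrightarrow>
      (X has_vector_derivative F (X t)) (at t within {0..S})"
    using solution_until_exit[OF L Q T] by metis
  define x y u where "x t = fst (X t)" and "y t = fst (snd (X t))" and "u t = snd (snd (X t))" for t
  show ?thesis
  proof (rule that[of x y u])
    show "x 0 = x_init" "y 0 = y_init" "u 0 = u_init" using X(1) by (auto simp: x_def y_def u_def)
    show "continuous_on {0..T} x" "continuous_on {0..T} y" "continuous_on {0..T} u"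
      unfolding x_def y_def u_def by (intro continuous_intros X(2))+
    fix S assume S: "S \<in> {0..T}"
      and region: "\<And>t. t \<in> {0..S} \<Longrightarrow> norm (x t) \<le> M1 \<and> \<bar>y t\<bar> \<le> M2 \<and> \<bar>u t\<bar> \<le> M3"
    have "X t \<in> Q" if "t \<in> {0..S}" for t
      using region[OF that] by (cases "X t") (auto simp: Q_def x_def y_def u_def)
    then have dX: "(X has_vector_derivative F (X t)) (at t within {0..S})" if "t \<in> {0..S}" for t
      using sol[OF S] that by blast
    show "regularized_solution f g \<phi> \<epsilon> \<alpha> S x y u"
      unfolding regularized_solution_def
    proof (intro ballI conjI)
      fix t assume t: "t \<in> {0..S}"
      have Xt: "X t = (x t, y t, u t)" by (simp add: x_def y_def u_def)
      note fst' = bounded_linear.has_vector_derivative[OF bounded_linear_fst]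
        and snd' = bounded_linear.has_vector_derivative[OF bounded_linear_snd]
      show "(x has_vector_derivative f (x t) (y t) (u t)) (at t within {0..S})"
        using fst'[OF dX[OF t]] by (simp add: Xt F_def flip: x_def)
      show "(y has_real_derivative g (x t) (y t) (u t)) (at t within {0..S})"
        using fst'[OF snd'[OF dX[OF t]]]
        by (simp add: Xt F_def has_real_derivative_iff_has_vector_derivative flip: y_def)
      have "(u has_real_derivative (1 / \<epsilon>) * (\<phi> ((y t + \<alpha> * u t) / \<epsilon>) - u t)) (at t within {0..S})"
        using snd'[OF snd'[OF dX[OF t]]]
        by (simp add: Xt F_def w_def has_real_derivative_iff_has_vector_derivative flip: u_def)
      then show "\<exists>u'. (u has_real_derivative u') (at t within {0..S}) \<and>
          \<epsilon> * u' = \<phi> ((y t + \<alpha> * u t) / \<epsilon>) - u t"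
        using \<epsilon> by fastforce
    qed
  qed
qed

section \<open>Constants from the sliding condition\<close>

lemma norm_triple_le:
  fixes x :: "'a::real_normed_vector" and y u :: real
  shows "norm (x, y, u) \<le> norm x + \<bar>y\<bar> + \<bar>u\<bar>"
  using norm_Pair_le[of x "(y, u)"] norm_Pair_le[of y u] by simp

text \<open>
  Compactness turns the pointwise sliding condition on \<open>y = 0\<close>, \<open>\<bar>u\<bar> \<le> 1\<close> into uniform constants. The
  derivative of \<open>g\<close> in \<open>u\<close> is at most \<open>-2 \<gamma>\<close> there, hence at most \<open>-\<gamma>\<close> in a neighbourhood by uniform
  continuity; and \<open>g\<close> is at least \<open>m\<close> away from zero at \<open>u = \<plusminus>1\<close>, so its zero lies at distance at least
  \<open>m / \<Lambda>\<close> from \<open>\<plusminus>1\<close>.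
\<close>

lemma sliding_region_exists:
  fixes f :: "'a::euclidean_space \<Rightarrow> real \<Rightarrow> real \<Rightarrow> 'a" and g :: "'a \<Rightarrow> real \<Rightarrow> real \<Rightarrow> real"
  assumes f: "smooth (\<lambda>(x, y, u). f x y u)" and g: "smooth (\<lambda>(x, y, u). g x y u)"
    and \<phi>: "regularizing_function \<phi>" and M: "0 < M"
    and sliding: "\<And>x. norm x \<le> M \<Longrightarrow> sliding_condition g x"
  obtains \<psi> \<delta> \<Lambda> B \<gamma> \<theta> c where "sliding_region f g \<phi> \<psi> (utkin_control g) M \<delta> \<Lambda> B \<gamma> \<theta> c"
proof -
  let ?f = "\<lambda>(x, y, u). f x y u" and ?g = "\<lambda>(x, y, u). g x y u"
  have f1: "Ck (Suc 0) ?f" and g1: "Ck (Suc 0) ?g"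
    using f g unfolding smooth_def by blast+
  define Q where "Q = cball (0::'a) M \<times> (cball (0::real) 1 \<times> cball (0::real) 2)"
  have Q: "compact Q" "convex Q"
    by (auto simp: Q_def intro!: compact_Times convex_Times)
  have in_Q: "(x, y, u) \<in> Q" if "norm x \<le> M" "\<bar>y\<bar> \<le> 1" "\<bar>u\<bar> \<le> 2" for x y u
    using that by (simp add: Q_def)
  obtain Lf where Lf: "Lf-lipschitz_on Q ?f"
    using C1_lipschitz_on_compact_convex[OF f1 Q] by blast
  obtain Lg where Lg: "Lg-lipschitz_on Q ?g"
    using C1_lipschitz_on_compact_convex[OF g1 Q] by blast
  define \<Lambda> where "\<Lambda> = max Lf Lg + 1"
  have \<Lambda>: "0 < \<Lambda>" "Lf \<le> \<Lambda>" "Lg \<le> \<Lambda>"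
    using lipschitz_on_nonneg[OF Lf] by (auto simp: \<Lambda>_def)
  have lip: "norm (h x y u - h x' y' u') \<le> \<Lambda> * (norm (x - x') + \<bar>y - y'\<bar> + \<bar>u - u'\<bar>)"
    if "L-lipschitz_on Q (\<lambda>(x, y, u). h x y u)" "L \<le> \<Lambda>" "(x, y, u) \<in> Q" "(x', y', u') \<in> Q"
    for h :: "'a \<Rightarrow> real \<Rightarrow> real \<Rightarrow> 'b::real_normed_vector" and L x y u x' y' u'
  proof -
    have "norm (h x y u - h x' y' u') \<le> L * norm (x - x', y - y', u - u')"
      using lipschitz_onD[OF that(1,3,4)] by (simp add: dist_norm)
    also have "\<dots> \<le> \<Lambda> * (norm (x - x') + \<bar>y - y'\<bar> + \<bar>u - u'\<bar>)"
      using that(2) \<Lambda> by (intro mult_mono norm_triple_le) auto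
    finally show ?thesis .
  qed
  have "continuous_on Q ?f" using Lf by (rule lipschitz_on_continuous_on)
  from bounded_on_compact[OF this Q(1)]
  obtain B where B: "\<And>z. z \<in> Q \<Longrightarrow> norm (?f z) \<le> B" by blast
  define g' where "g' z = frechet_derivative ?g (at z) (0, 0, 1)" for z
  have "continuous_on UNIV (\<lambda>z. frechet_derivative ?g (at z) (0, 0, 1))"
    using g1 unfolding Ck.simps by blast
  then have g'_cont: "continuous_on A g'" for A
    unfolding g'_def by (rule continuous_on_subset) simp
  have dg: "((\<lambda>u. g x y u) has_real_derivative g' (x, y, u)) (at u)" for x y u
  proof -
    have "(?g has_derivative frechet_derivative ?g (at (x, y, u))) (at (x, y, u))"
      using g1 by (simp add: frechet_derivative_works)
    moreover have "((\<lambda>u. (x, y, u)) has_derivative (\<lambda>h. (0, 0, h))) (at u)"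
      by (auto intro!: derivative_eq_intros)
    ultimately have "((\<lambda>u. ?g (x, y, u)) has_derivative
        (\<lambda>h. frechet_derivative ?g (at (x, y, u)) (0, 0, h))) (at u)"
      using has_derivative_compose[of "\<lambda>u. (x, y, u)" "\<lambda>h. (0, 0, h)" u UNIV ?g] by simp
    moreover have "frechet_derivative ?g (at (x, y, u)) (0, 0, h) = g' (x, y, u) * h" for h
    proof -
      have "linear (frechet_derivative ?g (at (x, y, u)))"
        using g1 by (simp add: linear_frechet_derivative)
      from linear_cmul[OF this, of h "(0, 0, 1)"] show ?thesis by (simp add: g'_def mult.commute)
    qed
    ultimately show ?thesis by (simp add: has_field_derivative_def)
  qed
  define Q0 where "Q0 = cball (0::'a) M \<times> ({0::real} \<times> {-1..1::real})"
  have g'_neg: "g' z < 0" if "z \<in> Q0" for z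
  proof -
    obtain x y u where xyu: "z = (x, y, u)" by (cases z)
    then have z: "z = (x, 0, u)" "norm x \<le> M" "u \<in> {-1..1}"
      using that by (auto simp: Q0_def)
    have "deriv (\<lambda>v. g x 0 v) u < 0"
      using sliding[OF z(2)] z(3) unfolding sliding_condition_def by blast
    then show ?thesis using DERIV_imp_deriv[OF dg[of x 0 u]] z(1) by simp
  qed
  have "compact Q0" by (auto simp: Q0_def intro!: compact_Times)
  moreover have "(0, 0, 0) \<in> Q0" using M by (simp add: Q0_def)
  ultimately obtain z0 where z0: "z0 \<in> Q0" "\<And>z. z \<in> Q0 \<Longrightarrow> g' z \<le> g' z0"
    using continuous_attains_sup[of Q0 g'] g'_cont by blast
  define \<gamma> where "\<gamma> = - g' z0 / 2"
  have \<gamma>: "0 < \<gamma>" using g'_neg[OF z0(1)] by (simp add: \<gamma>_def)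
  obtain d where d: "0 < d" "\<And>z z'. z \<in> Q \<Longrightarrow> z' \<in> Q \<Longrightarrow> dist z' z < d \<Longrightarrow> dist (g' z') (g' z) < \<gamma>"
    using compact_uniformly_continuous[OF g'_cont Q(1)] \<gamma> unfolding uniformly_continuous_on_def
    by blast
  define \<delta> where "\<delta> = min 1 (d / 3)"
  have \<delta>: "0 < \<delta>" "\<delta> \<le> 1" "2 * \<delta> < d" using d(1) by (auto simp: \<delta>_def)
  have g'_le: "g' (x, y, u) \<le> - \<gamma>" if "norm x \<le> M" "\<bar>y\<bar> \<le> \<delta>" "\<bar>u\<bar> \<le> 1 + \<delta>" for x y u
  proof -
    define v where "v = max (-1) (min 1 u)"
    have v: "\<bar>v\<bar> \<le> 1" "\<bar>u - v\<bar> \<le> \<delta>" using that(3) \<delta> by (auto simp: v_def)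
    have "norm ((x, y, u) - (x, 0, v)) \<le> \<bar>y\<bar> + \<bar>u - v\<bar>"
      using norm_triple_le[of "0::'a" y "u - v"] by simp
    then have "dist (x, y, u) (x, 0, v) < d" using v that \<delta> by (simp add: dist_norm)
    then have "dist (g' (x, y, u)) (g' (x, 0, v)) < \<gamma>"
      using that v \<delta> by (intro d(2) in_Q) auto
    moreover have "g' (x, 0, v) \<le> - 2 * \<gamma>"
      using z0(2)[of "(x, 0, v)"] that v by (auto simp: Q0_def \<gamma>_def abs_le_iff)
    ultimately show ?thesis by (auto simp: dist_real_def abs_less_iff)
  qed
  have g_decreasing: "\<gamma> * (q - p) \<le> g x y p - g x y q"
    if "norm x \<le> M" "\<bar>y\<bar> \<le> \<delta>" "\<bar>p\<bar> \<le> 1 + \<delta>" "\<bar>q\<bar> \<le> 1 + \<delta>" "p \<le> q" for x y p q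
  proof (cases "p = q")
    case False
    then have "p < q" using that by simp
    then obtain s where s: "p < s" "s < q" "g x y q - g x y p = (q - p) * g' (x, y, s)"
      using MVT2[of p q "\<lambda>u. g x y u" "\<lambda>u. g' (x, y, u)"] dg by blast
    have "(q - p) * g' (x, y, s) \<le> (q - p) * - \<gamma>"
      using g'_le[OF that(1,2), of s] s that by (intro mult_left_mono) auto
    then show ?thesis using s(3) by (simp add: mult.commute)
  qed simp
  have slice: "continuous_on (cball 0 M) (\<lambda>x. g x 0 v)" for v
  proof -
    have "continuous_on UNIV ?g"
      using g1 by (auto intro!: differentiable_imp_continuous_on simp: differentiable_on_def
          intro: differentiable_at_withinI)
    then have "continuous_on (cball 0 M) (\<lambda>x. ?g (x, 0, v))"
      by (rule continuous_on_compose2) (auto intro!: continuous_intros)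
    then show ?thesis by simp
  qed
  obtain xp where xp: "norm xp \<le> M" "\<And>x. norm x \<le> M \<Longrightarrow> g x 0 1 \<le> g xp 0 1"
    using continuous_attains_sup[OF compact_cball _ slice[of 1]] M by auto
  obtain xm where xm: "norm xm \<le> M" "\<And>x. norm x \<le> M \<Longrightarrow> g xm 0 (-1) \<le> g x 0 (-1)"
    using continuous_attains_inf[OF compact_cball _ slice[of "-1"]] M by auto
  define m where "m = min (- g xp 0 1) (g xm 0 (-1))"
  have m: "0 < m" "\<And>x. norm x \<le> M \<Longrightarrow> g x 0 1 \<le> - m" "\<And>x. norm x \<le> M \<Longrightarrow> m \<le> g x 0 (-1)"
    using sliding[OF xp(1)] sliding[OF xm(1)] xp(2) xm(2)
    by (force simp: m_def sliding_condition_def)+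
  define \<theta> where "\<theta> = min 1 (m / \<Lambda>)"
  have \<theta>: "0 < \<theta>" "\<theta> \<le> 1" "\<theta> \<le> m / \<Lambda>" using m \<Lambda> by (auto simp: \<theta>_def)
  have U: "utkin_control g x \<in> {-1..1}" "g x 0 (utkin_control g x) = 0" if "norm x \<le> M" for x
    using utkin_control(2,3)[OF g sliding[OF that]] by auto
  have U_bound: "\<bar>utkin_control g x\<bar> \<le> 1 - \<theta>" if x: "norm x \<le> M" for x
  proof -
    define v where "v = utkin_control g x"
    have v: "\<bar>v\<bar> \<le> 1" "g x 0 v = 0" using U[OF x] by (auto simp: v_def)
    have near: "\<bar>g x 0 v - g x 0 q\<bar> \<le> \<Lambda> * \<bar>v - q\<bar>" if "\<bar>q\<bar> \<le> 1" for q
      using lip[OF Lg \<Lambda>(3), of x 0 v x 0 q] in_Q[of x] x v that by simp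
    have "m / \<Lambda> \<le> 1 - v" "m / \<Lambda> \<le> 1 + v"
      using near[of 1] near[of "-1"] m(2)[OF x] m(3)[OF x] v \<Lambda>
      by (auto simp: field_simps abs_if split: if_splits)
    then show ?thesis using \<theta>(3) by (simp add: v_def abs_le_iff)
  qed
  obtain \<psi> c where \<psi>: "0 < c"
    "\<And>p. \<bar>p\<bar> \<le> 1 - \<theta> \<Longrightarrow> \<bar>\<psi> p\<bar> \<le> 1"
    "\<And>p q. \<bar>p\<bar> \<le> 1 - \<theta> \<Longrightarrow> \<bar>q\<bar> \<le> 1 - \<theta> \<Longrightarrow> \<bar>\<psi> p - \<psi> q\<bar> \<le> \<bar>p - q\<bar> / c"
    "\<And>p s. \<bar>p\<bar> \<le> 1 - \<theta> \<Longrightarrow> 0 \<le> s \<Longrightarrow> p + min (c * s) (\<theta> / 2) \<le> \<phi> (\<psi> p + s)"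
    "\<And>p s. \<bar>p\<bar> \<le> 1 - \<theta> \<Longrightarrow> 0 \<le> s \<Longrightarrow> \<phi> (\<psi> p - s) \<le> p - min (c * s) (\<theta> / 2)"
    using regularizing_function_inverse[OF \<phi> \<theta>(1,2)] by metis
  have "sliding_region f g \<phi> \<psi> (utkin_control g) M \<delta> \<Lambda> B \<gamma> \<theta> c"
  proof
    fix x x' :: 'a and y y' u u' :: real
    assume "norm x \<le> M" "norm x' \<le> M" "\<bar>y\<bar> \<le> \<delta>" "\<bar>y'\<bar> \<le> \<delta>" "\<bar>u\<bar> \<le> 1 + \<delta>" "\<bar>u'\<bar> \<le> 1 + \<delta>"
    then have z: "(x, y, u) \<in> Q" "(x', y', u') \<in> Q" using \<delta> by (auto intro!: in_Q)
    show "norm (f x y u - f x' y' u') \<le> \<Lambda> * (norm (x - x') + \<bar>y - y'\<bar> + \<bar>u - u'\<bar>)"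
      by (rule lip[OF Lf \<Lambda>(2) z])
    show "\<bar>g x y u - g x' y' u'\<bar> \<le> \<Lambda> * (norm (x - x') + \<bar>y - y'\<bar> + \<bar>u - u'\<bar>)"
      using lip[OF Lg \<Lambda>(3) z] by simp
  next
    show "norm (f x y u) \<le> B" if "norm x \<le> M" "\<bar>y\<bar> \<le> \<delta>" "\<bar>u\<bar> \<le> 1 + \<delta>" for x y u
      using B[of "(x, y, u)"] in_Q[of x y u] that \<delta> by simp
    show "0 \<le> B" using order_trans[OF norm_ge_zero B[OF in_Q[of 0 0 0]]] M by simp
  qed (use \<phi> \<delta> \<Lambda> \<gamma> \<theta> U U_bound \<psi> g_decreasing in auto)
  then show ?thesis by (rule that)
qed

section \<open>Convergence to Utkin's equivalent control\<close>

theorem theorem5: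
  fixes f :: "real ^ 'm \<Rightarrow> real \<Rightarrow> real \<Rightarrow> real ^ 'm"
    and g :: "real ^ 'm \<Rightarrow> real \<Rightarrow> real \<Rightarrow> real"
    and \<phi> :: "real \<Rightarrow> real"
    and M T :: real
    and x_U :: "real \<Rightarrow> real ^ 'm"
  assumes "smooth (\<lambda>(x, y, u). f x y u)"
    and "smooth (\<lambda>(x, y, u). g x y u)"
    and "regularizing_function \<phi>"
    and "M > 0"
    and "\<And>x. norm x \<le> M \<Longrightarrow> sliding_condition g x"
    and "T > 0"
    and "utkin_solution f g T x_U"
    and "\<And>t. t \<in> {0..T} \<Longrightarrow> norm (x_U t) < M"
  shows "\<exists>\<alpha>\<^sub>0>0. \<exists>\<kappa>\<^sub>0>0. \<forall>\<delta>\<^sub>0 \<kappa>.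
    0 < \<delta>\<^sub>0 \<and> \<kappa> < 0 \<and> \<bar>\<kappa>\<bar> \<le> \<kappa>\<^sub>0 \<and> \<delta>\<^sub>0 \<le> \<bar>\<kappa>\<bar> * \<alpha>\<^sub>0 \<longrightarrow>
      (\<exists>L>0. \<forall>\<alpha> \<epsilon> y\<^sub>0 u\<^sub>0.
        \<alpha> < 0 \<and> \<bar>\<alpha>\<bar> \<le> \<alpha>\<^sub>0 \<and> \<epsilon> = \<kappa> * \<alpha> \<and> \<bar>y\<^sub>0\<bar> < \<bar>\<alpha>\<bar> \<and> \<bar>\<bar>u\<^sub>0\<bar> - 1\<bar> < \<delta>\<^sub>0 \<longrightarrow>
          (\<exists>x y u. regularized_solution f g \<phi> \<epsilon> \<alpha> T x y u \<and>
             x 0 = x_U 0 \<and> y 0 = y\<^sub>0 \<and> u 0 = u\<^sub>0) \<and>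
          (\<forall>x y u. regularized_solution f g \<phi> \<epsilon> \<alpha> T x y u \<and>
             x 0 = x_U 0 \<and> y 0 = y\<^sub>0 \<and> u 0 = u\<^sub>0 \<longrightarrow>
             (\<forall>t\<in>{0<..<T}. norm (x t - x_U t) < L * \<bar>\<alpha>\<bar> \<and> \<bar>y t\<bar> < L * \<bar>\<alpha>\<bar>)))"
proof -
  note f = assms(1) and g = assms(2) and \<phi> = assms(3) and T = assms(6)
  obtain \<psi> \<delta> \<Lambda> B \<gamma> \<theta> c where
    "sliding_region f g \<phi> \<psi> (utkin_control g) M \<delta> \<Lambda> B \<gamma> \<theta> c"
    by (rule sliding_region_exists[OF f g \<phi> assms(4,5)])
  then interpret sliding_region f g \<phi> \<psi> "utkin_control g" M \<delta> \<Lambda> B \<gamma> \<theta> c .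
  have C1: "Ck (Suc 0) (\<lambda>(x, y, u). f x y u)" "Ck (Suc 0) (\<lambda>(x, y, u). g x y u)" "Ck (Suc 0) \<phi>"
    using f g \<phi> unfolding regularizing_function_def smooth_def by blast+
  have xU: "(x_U has_vector_derivative f (x_U t) 0 (utkin_control g (x_U t))) (at t within {0..T})"
    if "t \<in> {0..T}" for t
    using assms(7) that unfolding utkin_solution_def utkin_field_def by blast
  have "continuous_on {0..T} x_U"
    using xU has_vector_derivative_continuous continuous_on_eq_continuous_within by blast
  then have "\<exists>s\<in>{0..T}. \<forall>t\<in>{0..T}. norm (x_U t) \<le> norm (x_U s)"
    by (intro continuous_attains_sup continuous_intros) (use T in auto)
  then obtain s where s: "s \<in> {0..T}" "\<And>t. t \<in> {0..T} \<Longrightarrow> norm (x_U t) \<le> norm (x_U s)" by blast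
  define r where "r = M - norm (x_U s)"
  have r: "0 < r" using assms(8)[OF s(1)] by (simp add: r_def)
  define D where "D = K * (1 + T) * exp (A * T)"
  have D: "0 < D" using K_pos T by (simp add: D_def)
  \<comment> \<open>The three terms keep \<open>\<bar>y\<bar> < 14 a\<close> inside the region, make the final size \<open>N a\<close> of the corner at most 1, and
    keep \<open>x\<close> in the ball of radius \<open>M\<close>. They do not involve \<open>\<kappa>\<close>.\<close>
  define \<alpha>\<^sub>0 where "\<alpha>\<^sub>0 = min (\<delta> / 14) (min (1 / (N + 1)) (r / D))"
  define \<kappa>\<^sub>0 where "\<kappa>\<^sub>0 = 1 / (\<Lambda> + 1)"
  have \<alpha>\<^sub>0: "0 < \<alpha>\<^sub>0" "\<alpha>\<^sub>0 \<le> \<delta> / 14" "\<alpha>\<^sub>0 \<le> 1 / (N + 1)" "\<alpha>\<^sub>0 \<le> r / D"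
    using \<delta> N_nonneg r D unfolding \<alpha>\<^sub>0_def by (simp, linarith+)
  have \<kappa>\<^sub>0: "0 < \<kappa>\<^sub>0" "\<kappa>\<^sub>0 \<le> 1" "\<kappa>\<^sub>0 * \<Lambda> \<le> 1" using \<Lambda> by (auto simp: \<kappa>\<^sub>0_def)
  have main: "(\<exists>x y u. regularized_solution f g \<phi> \<epsilon> \<alpha> T x y u \<and>
             x 0 = x_U 0 \<and> y 0 = y\<^sub>0 \<and> u 0 = u\<^sub>0) \<and>
          (\<forall>x y u. regularized_solution f g \<phi> \<epsilon> \<alpha> T x y u \<and>
             x 0 = x_U 0 \<and> y 0 = y\<^sub>0 \<and> u 0 = u\<^sub>0 \<longrightarrow>
             (\<forall>t\<in>{0<..<T}. norm (x t - x_U t) < (D + 14) * \<bar>\<alpha>\<bar> \<and> \<bar>y t\<bar> < (D + 14) * \<bar>\<alpha>\<bar>))"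
    if \<kappa>: "\<kappa> < 0" "\<bar>\<kappa>\<bar> \<le> \<kappa>\<^sub>0" "\<delta>\<^sub>0 \<le> \<bar>\<kappa>\<bar> * \<alpha>\<^sub>0"
      and \<alpha>: "\<alpha> < 0" "\<bar>\<alpha>\<bar> \<le> \<alpha>\<^sub>0" "\<epsilon> = \<kappa> * \<alpha>" and ini: "\<bar>y\<^sub>0\<bar> < \<bar>\<alpha>\<bar>" "\<bar>\<bar>u\<^sub>0\<bar> - 1\<bar> < \<delta>\<^sub>0"
    for \<delta>\<^sub>0 \<kappa> \<alpha> \<epsilon> y\<^sub>0 u\<^sub>0
  proof -
    define a k where "a = - \<alpha>" and "k = - \<kappa>"
    have eqs: "\<epsilon> = k * a" "\<alpha> = - a" "\<bar>\<alpha>\<bar> = a" "\<bar>\<kappa>\<bar> = k" using \<alpha> \<kappa> by (auto simp: a_def k_def)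
    have k: "0 < k" "k \<le> 1" using \<kappa> \<kappa>\<^sub>0 by (auto simp: k_def)
    have "k * \<Lambda> \<le> \<kappa>\<^sub>0 * \<Lambda>" using \<kappa> \<Lambda> by (intro mult_right_mono) (auto simp: k_def)
    then have k\<Lambda>: "k * \<Lambda> \<le> 1" using \<kappa>\<^sub>0 by simp
    have a: "0 < a" "a \<le> \<alpha>\<^sub>0" using \<alpha> by (auto simp: a_def)
    have a\<delta>: "14 * a \<le> \<delta>" using a \<alpha>\<^sub>0 by simp
    have "(N + 1) * a \<le> (N + 1) * (1 / (N + 1))"
      using a \<alpha>\<^sub>0 N_nonneg by (intro mult_left_mono) auto
    then have "(N + 1) * a \<le> 1" using N_nonneg by simp
    then have aN: "N * a \<le> 1" using a by (simp add: algebra_simps)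
    have "D * a \<le> D * (r / D)" using a \<alpha>\<^sub>0 D by (intro mult_left_mono) auto
    then have aD: "D * a \<le> r" using D by simp
    have room: "norm (x_U t) + K * (1 + T) * exp (A * T) * a \<le> M" if "t \<in> {0..T}" for t
      using s(2)[OF that] aD by (simp add: r_def D_def)
    have "k * \<alpha>\<^sub>0 \<le> 1 * \<alpha>\<^sub>0" using k \<alpha>\<^sub>0 by (intro mult_right_mono) auto
    then have "\<delta>\<^sub>0 \<le> \<delta>" using \<kappa>(3) \<alpha>\<^sub>0(2) \<delta> unfolding eqs(4) by linarith
    then have u\<^sub>0: "\<bar>u\<^sub>0\<bar> < 1 + \<delta>" using ini(2) by linarith
    have y\<^sub>0: "\<bar>y\<^sub>0\<bar> < a" using ini(1) eqs by simp
    have T0: "0 \<le> T" "T \<in> {0..T}" using T by auto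
    have existence: "\<exists>x y u. regularized_solution f g \<phi> (k * a) (- a) T x y u \<and>
        x 0 = x_U 0 \<and> y 0 = y\<^sub>0 \<and> u 0 = u\<^sub>0"
    proof -
      have pos: "0 < k * a" "0 \<le> M" "0 \<le> 14 * a" "0 \<le> 1 + \<delta>"
        using a k assms(4) \<delta> by auto
      show ?thesis
      proof (rule regularized_solution_until_exit[where x_init = "x_U 0" and y_init = y\<^sub>0
            and u_init = u\<^sub>0 and \<alpha> = "- a", OF C1 pos(1) T0(1) pos(2-4)])
        fix x y u
        assume i: "x 0 = x_U 0" "y 0 = y\<^sub>0" "u 0 = u\<^sub>0"
          and cont: "continuous_on {0..T} x" "continuous_on {0..T} y" "continuous_on {0..T} u"
          and loc: "\<And>S. S \<in> {0..T} \<Longrightarrow>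
            (\<And>t. t \<in> {0..S} \<Longrightarrow> norm (x t) \<le> M \<and> \<bar>y t\<bar> \<le> 14 * a \<and> \<bar>u t\<bar> \<le> 1 + \<delta>) \<Longrightarrow>
            regularized_solution f g \<phi> (k * a) (- a) S x y u"
        have i': "\<bar>y 0\<bar> < a" "\<bar>u 0\<bar> < 1 + \<delta>" using i y\<^sub>0 u\<^sub>0 by simp_all
        have "regularized_solution f g \<phi> (k * a) (- a) T x y u"
          by (rule tracking(5)[where xU = x_U and x = x and y = y and u = u and a = a,
            OF _ cont a(1) a\<delta> aN k k\<Lambda> i(1) i' _ _ T0(2)]) (fact loc xU room)+
        then show ?thesis using i by blast
      qed
    qed
    have estimate: "norm (x t - x_U t) < (D + 14) * a \<and> \<bar>y t\<bar> < (D + 14) * a"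
      if sol: "regularized_solution f g \<phi> (k * a) (- a) T x y u"
        and i: "x 0 = x_U 0" "y 0 = y\<^sub>0" "u 0 = u\<^sub>0" and t: "t \<in> {0..T}" for x y u t
    proof -
      have loc: "regularized_solution f g \<phi> (k * a) (- a) S x y u" if "S \<in> {0..T}" for S
        by (rule regularized_solution_restrict[OF sol]) (use that in auto)
      have cont: "continuous_on {0..T} x" "continuous_on {0..T} y" "continuous_on {0..T} u"
        by (rule regularized_solution_continuous[OF sol])+
      have i': "\<bar>y 0\<bar> < a" "\<bar>u 0\<bar> < 1 + \<delta>" using i y\<^sub>0 u\<^sub>0 by simp_all
      have "\<bar>y t\<bar> < 14 * a"
        by (rule tracking(3)[where xU = x_U and x = x and y = y and u = u and a = a,
            OF _ cont a(1) a\<delta> aN k k\<Lambda> i(1) i' _ _ t]) (fact xU room | erule loc)+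
      moreover have "norm (x t - x_U t) < D * a"
        unfolding D_def
        by (rule tracking(4)[where xU = x_U and x = x and y = y and u = u and a = a,
            OF _ cont a(1) a\<delta> aN k k\<Lambda> i(1) i' _ _ t]) (fact xU room | erule loc)+
      moreover have "0 < D * a" using D a by simp
      ultimately show ?thesis using a by (simp add: distrib_right)
    qed
    show ?thesis using existence estimate unfolding eqs(3) unfolding eqs(1,2) by auto
  qed
  show ?thesis
    by (intro exI[of _ \<alpha>\<^sub>0] exI[of _ \<kappa>\<^sub>0] exI[of _ "D + 14"] conjI allI impI main)
      (use \<alpha>\<^sub>0 \<kappa>\<^sub>0 D in auto)
qed

end
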